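(* Suppose that $u_0:[0,1]\to\mathbb C$ is piecewise $C^2$ on $[0,1]$. Let $u(x,t)$ be defined, for $x\in(0,1)$ and $t>0$, by $$u(x,t)=\frac1{2\pi}\int_{\mathbb R}e^{ikx+ik^3t}\,\widehat{u_0}(k)\,dk+\frac1{2\pi}\left\{\int_{\Gamma^+}e^{ikx+ik^3t}\frac{\zeta^+(k)}{\Delta(k)}\,dk+\int_{\Gamma^-}e^{ik(x-1)+ik^3t}\frac{\zeta^-(k)}{\Delta(k)}\,dk\right\}.$$ Then, for all $t>0$, $u(\cdot,t)\in C(0,1)$, i.e. $x\mapsto u(x,t)$ is continuous on the open interval $(0,1)$.
   Context: Piecewise $C^2$ means: there is a partition $0=y_0<y_1<\dots<y_n=1$ such that each restriction $u_0|_{(y_j,y_{j+1})}$ extends to a function in $C^2[y_j,y_{j+1}]$. Notation: $\alpha=e^{2\pi i/3}$; $\widehat{u_0}(k)=\int_0^1e^{-ikx}u_0(x)\,dx$ for $k\in\mathbb C$; $$\Delta(k)=e^{-ik}+\alpha e^{-i\alpha k}+\alpha^2e^{-i\alpha^2k},$$ $$\zeta^-(k)=\widehat{u_0}(k)+\alpha\widehat{u_0}(\alpha k)+\alpha^2\widehat{u_0}(\alpha^2k),\qquad \zeta^+(k)=e^{-ik}\zeta^-(k)-\widehat{u_0}(k)\Delta(k).$$ $\mathbb C^\pm$ denote the open upper and lower half planes. $\Gamma^\pm$ is the positively oriented boundary (region on the left) of $\{k\in\mathbb C^\pm:\operatorname{Re}(ik^3)>0\}$. Thus $\Gamma^+$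 is the boundary of the sector $\pi/3<\arg k<2\pi/3$, and $\Gamma^-$ is the boundary of the union of the sectors $-\pi<\arg k<-2\pi/3$ and $-\pi/3<\arg k<0$. The only zero of $\Delta$ on these contours is $k=0$, where $\zeta^\pm/\Delta$ has a removable singularity. The integrals are understood as (possibly conditionally convergent) improper integrals. The function $u$ is the unified-transform representation of the solution of $u_t+u_{xxx}=0$ on $(0,1)$ with $u(0,t)=u(1,t)=0$, $u_x(1,t)=0$, $u(\cdot,0)=u_0$. *)

theory Defs
  imports "HOL-Complex_Analysis.Complex_Analysis"
begin

definition C2_on :: "real set \<Rightarrow> (real \<Rightarrow> complex) \<Rightarrow> bool" where
  "C2_on S g \<longleftrightarrow> (\<exists>g' g''.
     (\<forall>x\<in>S. (g has_vector_derivative g' x) (at x within S)) \<and>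
     (\<forall>x\<in>S. (g' has_vector_derivative g'' x) (at x within S)) \<and>
     continuous_on S g'')"

text \<open>Functions on the unit interval are total functions on the reals whose values outside
  \<open>{0..1}\<close> play no role. The values at the nodes of the partition are unconstrained.\<close>

definition piecewise_C2 :: "(real \<Rightarrow> complex) \<Rightarrow> bool" where
  "piecewise_C2 u0 \<longleftrightarrow> (\<exists>(n::nat) (y :: nat \<Rightarrow> real).
     y 0 = 0 \<and> y n = 1 \<and> (\<forall>j<n. y j < y (Suc j)) \<and>
     (\<forall>j<n. \<exists>g. C2_on {y j..y (Suc j)} g \<and> (\<forall>x\<in>{y j<..<y (Suc j)}. g x = u0 x)))"

definition alpha :: complex where
  "alpha = exp (2 * of_real pi * \<i> / 3)"

definition uhat :: "(real \<Rightarrow> complex) \<Rightarrow> complex \<Rightarrow> complex" where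
  "uhat u0 k = integral {0..1} (\<lambda>x. exp (- \<i> * k * of_real x) * u0 x)"

definition Delta :: "complex \<Rightarrow> complex" where
  "Delta k = exp (- \<i> * k) + alpha * exp (- \<i> * alpha * k) + alpha\<^sup>2 * exp (- \<i> * alpha\<^sup>2 * k)"

definition zeta_minus :: "(real \<Rightarrow> complex) \<Rightarrow> complex \<Rightarrow> complex" where
  "zeta_minus u0 k = uhat u0 k + alpha * uhat u0 (alpha * k) + alpha\<^sup>2 * uhat u0 (alpha\<^sup>2 * k)"

definition zeta_plus :: "(real \<Rightarrow> complex) \<Rightarrow> complex \<Rightarrow> complex" where
  "zeta_plus u0 k = exp (- \<i> * k) * zeta_minus u0 k - uhat u0 k * Delta k"

text \<open>Improper integrals over the real line: both endpoints tend to infinity independently, so this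
  is not a principal value.\<close>

definition improper_integrable :: "(real \<Rightarrow> complex) \<Rightarrow> bool" where
  "improper_integrable f \<longleftrightarrow>
     (\<forall>a b. f integrable_on {a..b}) \<and>
     (\<exists>I. ((\<lambda>(a, b). integral {a..b} f) \<longlongrightarrow> I) (at_bot \<times>\<^sub>F at_top))"

definition improper_integral :: "(real \<Rightarrow> complex) \<Rightarrow> complex" where
  "improper_integral f = Lim (at_bot \<times>\<^sub>F at_top) (\<lambda>(a, b). integral {a..b} f)"

text \<open>Improper integrals along the ray of argument \<open>\<theta>\<close>, directed from the origin to infinity.\<close>

definition ray_integrable :: "real \<Rightarrow> (complex \<Rightarrow> complex) \<Rightarrow> bool" where
  "ray_integrable \<theta> f \<longleftrightarrow>
     (\<forall>R>0. f contour_integrable_on linepath 0 (rcis R \<theta>)) \<and>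
     (\<exists>I. ((\<lambda>R. contour_integral (linepath 0 (rcis R \<theta>)) f) \<longlongrightarrow> I) at_top)"

definition ray_integral :: "real \<Rightarrow> (complex \<Rightarrow> complex) \<Rightarrow> complex" where
  "ray_integral \<theta> f = Lim at_top (\<lambda>R. contour_integral (linepath 0 (rcis R \<theta>)) f)"

text \<open>The boundary of the sector \<open>a < arg k < b\<close> with the sector on the left: in from infinity along
  the ray of argument \<open>b\<close>, then out to infinity along the ray of argument \<open>a\<close>.\<close>

definition sector_boundary_integrable :: "real \<Rightarrow> real \<Rightarrow> (complex \<Rightarrow> complex) \<Rightarrow> bool" where
  "sector_boundary_integrable a b f \<longleftrightarrow> ray_integrable a f \<and> ray_integrable b f"

definition sector_boundary_integral :: "real \<Rightarrow> real \<Rightarrow> (complex \<Rightarrow> complex) \<Rightarrow> complex" where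
  "sector_boundary_integral a b f = ray_integral a f - ray_integral b f"

definition open_sector :: "real \<Rightarrow> real \<Rightarrow> complex set" where
  "open_sector a b = {rcis r \<theta> |r \<theta>. 0 < r \<and> a < \<theta> \<and> \<theta> < b}"

lemma Re_i_rcis_cubed: "Re (\<i> * rcis r \<theta> ^ 3) = - (r ^ 3 * sin (3 * \<theta>))"
  by (simp only: DeMoivre2) (simp add: rcis_def)

text \<open>The contours are the positively oriented boundaries of the following two regions.\<close>

lemma region_plus:
  "{k. Im k > 0 \<and> Re (\<i> * k ^ 3) > 0} = open_sector (pi/3) (2*pi/3)"
proof (intro equalityI subsetI)
  fix k assume "k \<in> {k. Im k > 0 \<and> Re (\<i> * k ^ 3) > 0}"
  then have k: "Im k > 0" "Re (\<i> * k ^ 3) > 0" by auto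
  define r \<theta> where "r = cmod k" and "\<theta> = Arg k"
  have kr: "k = rcis r \<theta>" by (simp add: r_def \<theta>_def rcis_cmod_Arg)
  have r: "r > 0" using k(1) unfolding r_def by auto
  have th: "0 < \<theta>" "\<theta> < pi" using k(1) Arg_lt_pi[of k] by (auto simp: \<theta>_def)
  have s: "sin (3 * \<theta>) < 0"
    using k(2) r unfolding kr Re_i_rcis_cubed by (simp add: mult_less_0_iff)
  have "pi/3 < \<theta>" 
  proof (rule ccontr)
    assume "\<not> pi/3 < \<theta>" then have "sin (3*\<theta>) \<ge> 0" using th by (intro sin_ge_zero) auto
    with s show False by simp
  qed
  moreover have "\<theta> < 2*pi/3"
  proof (rule ccontr)
    assume "\<not> \<theta> < 2*pi/3" then have "sin (3*\<theta> - 2*pi) \<ge> 0" using th by (intro sin_ge_zero) auto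
    with s show False by (simp add: sin_diff)
  qed
  ultimately show "k \<in> open_sector (pi/3) (2*pi/3)" using kr r by (auto simp: open_sector_def)
next
  fix k assume "k \<in> open_sector (pi/3) (2*pi/3)"
  then obtain r \<theta> where k: "k = rcis r \<theta>" "r > 0" "pi/3 < \<theta>" "\<theta> < 2*pi/3"
    by (auto simp: open_sector_def)
  have "sin \<theta> > 0" using k by (intro sin_gt_zero) auto
  moreover have "sin (3*\<theta>) < 0" using k by (intro sin_lt_zero) auto
  ultimately show "k \<in> {k. Im k > 0 \<and> Re (\<i> * k ^ 3) > 0}"
    using k(2) unfolding mem_Collect_eq k(1) Re_i_rcis_cubed by (auto simp: mult_less_0_iff)
qed

lemma region_minus:
  "{k. Im k < 0 \<and> Re (\<i> * k ^ 3) > 0} = open_sector (-pi) (-2*pi/3) \<union> open_sector (-pi/3) 0"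
proof (intro equalityI subsetI)
  fix k assume "k \<in> {k. Im k < 0 \<and> Re (\<i> * k ^ 3) > 0}"
  then have k: "Im k < 0" "Re (\<i> * k ^ 3) > 0" by auto
  define r \<theta> where "r = cmod k" and "\<theta> = Arg k"
  have kr: "k = rcis r \<theta>" by (simp add: r_def \<theta>_def rcis_cmod_Arg)
  have r: "r > 0" using k(1) unfolding r_def by auto
  have th: "- pi < \<theta>" "\<theta> < 0" using k(1) mpi_less_Arg[of k] Arg_neg_iff[of k] by (auto simp: \<theta>_def)
  have s: "sin (3 * \<theta>) < 0"
    using k(2) r unfolding kr Re_i_rcis_cubed by (simp add: mult_less_0_iff)
  have "\<theta> < -2*pi/3 \<or> -pi/3 < \<theta>"
  proof (rule ccontr)
    assume "\<not> (\<theta> < -2*pi/3 \<or> -pi/3 < \<theta>)"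
    then have "sin (3*\<theta> + 2*pi) \<ge> 0" by (intro sin_ge_zero) auto
    with s show False by simp
  qed
  then show "k \<in> open_sector (-pi) (-2*pi/3) \<union> open_sector (-pi/3) 0"
    using kr r th unfolding open_sector_def by blast
next
  fix k assume "k \<in> open_sector (-pi) (-2*pi/3) \<union> open_sector (-pi/3) 0"
  then obtain r \<theta> where k: "k = rcis r \<theta>" "r > 0"
    and th: "-pi < \<theta> \<and> \<theta> < -2*pi/3 \<or> -pi/3 < \<theta> \<and> \<theta> < 0"
    unfolding open_sector_def by blast
  have "- pi < \<theta> \<and> \<theta> < 0"
    using th pi_gt_zero by linarith
  then have "sin (- \<theta>) > 0" by (intro sin_gt_zero) auto
  moreover have "sin (3*\<theta>) < 0"
    using th
  proof
    assume "-pi < \<theta> \<and> \<theta> < -2*pi/3"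
    then have "sin (- (3*\<theta>) - 2*pi) > 0" by (intro sin_gt_zero) auto
    then show ?thesis by (simp add: sin_diff)
  next
    assume "-pi/3 < \<theta> \<and> \<theta> < 0"
    then have "sin (- (3*\<theta>)) > 0" by (intro sin_gt_zero) auto
    then show ?thesis by simp
  qed
  ultimately show "k \<in> {k. Im k < 0 \<and> Re (\<i> * k ^ 3) > 0}"
    using k(2) unfolding mem_Collect_eq k(1) Re_i_rcis_cubed by (auto simp: mult_less_0_iff mult_pos_neg)
qed

definition Gamma_plus_integrable :: "(complex \<Rightarrow> complex) \<Rightarrow> bool" where
  "Gamma_plus_integrable f \<longleftrightarrow> sector_boundary_integrable (pi/3) (2*pi/3) f"

definition Gamma_plus_integral :: "(complex \<Rightarrow> complex) \<Rightarrow> complex" where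
  "Gamma_plus_integral f = sector_boundary_integral (pi/3) (2*pi/3) f"

definition Gamma_minus_integrable :: "(complex \<Rightarrow> complex) \<Rightarrow> bool" where
  "Gamma_minus_integrable f \<longleftrightarrow>
     sector_boundary_integrable (-pi) (-2*pi/3) f \<and> sector_boundary_integrable (-pi/3) 0 f"

definition Gamma_minus_integral :: "(complex \<Rightarrow> complex) \<Rightarrow> complex" where
  "Gamma_minus_integral f =
     sector_boundary_integral (-pi) (-2*pi/3) f + sector_boundary_integral (-pi/3) 0 f"

definition integrand_line :: "(real \<Rightarrow> complex) \<Rightarrow> real \<Rightarrow> real \<Rightarrow> real \<Rightarrow> complex" where
  "integrand_line u0 x t k =
     exp (\<i> * of_real k * of_real x + \<i> * of_real k ^ 3 * of_real t) * uhat u0 (of_real k)"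

text \<open>At \<open>k = 0\<close>, where the quotients below have a removable singularity, they evaluate to \<open>0\<close> by the
  convention for division; the value at a single point does not affect the integrals.\<close>

definition integrand_plus :: "(real \<Rightarrow> complex) \<Rightarrow> real \<Rightarrow> real \<Rightarrow> complex \<Rightarrow> complex" where
  "integrand_plus u0 x t k =
     exp (\<i> * k * of_real x + \<i> * k ^ 3 * of_real t) * (zeta_plus u0 k / Delta k)"

definition integrand_minus :: "(real \<Rightarrow> complex) \<Rightarrow> real \<Rightarrow> real \<Rightarrow> complex \<Rightarrow> complex" where
  "integrand_minus u0 x t k =
     exp (\<i> * k * (of_real x - 1) + \<i> * k ^ 3 * of_real t) * (zeta_minus u0 k / Delta k)"

definition ut_integrals_converge :: "(real \<Rightarrow> complex) \<Rightarrow> real \<Rightarrow> real \<Rightarrow> bool" where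
  "ut_integrals_converge u0 x t \<longleftrightarrow>
     improper_integrable (integrand_line u0 x t) \<and>
     Gamma_plus_integrable (integrand_plus u0 x t) \<and>
     Gamma_minus_integrable (integrand_minus u0 x t)"

definition ut_solution :: "(real \<Rightarrow> complex) \<Rightarrow> real \<Rightarrow> real \<Rightarrow> complex" where
  "ut_solution u0 x t =
     1 / (2 * of_real pi) * improper_integral (integrand_line u0 x t) +
     1 / (2 * of_real pi) *
       (Gamma_plus_integral (integrand_plus u0 x t) + Gamma_minus_integral (integrand_minus u0 x t))"

end

theory Submission
  imports Defs
begin

text \<open>
  Every contour is a union of rays \<open>k = w r\<close>, \<open>r > 0\<close>, with \<open>w\<close> a sixth root of unity: the positive
  and negative real half-lines and the rays of argument \<open>\<plusminus>\<pi>/3\<close>, \<open>\<plusminus>2\<pi>/3\<close>. There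
  \<open>k\<^sup>3 = \<plusminus>r\<^sup>3\<close>, so the time factor has modulus one and only oscillates. After the \<open>x\<close>-dependence
  is separated, each integrand has the form \<open>exp (\<plusminus> \<i> t r\<^sup>3 + c(x) r) h(r)\<close> with
  \<open>Re c(x) \<le> 0\<close> and \<open>\<bar>c(x)\<bar> \<le> 1\<close>.

  Suppose that \<open>h\<close> and \<open>h'\<close> are bounded on \<open>r \<ge> 1\<close>. One integration by parts against
  \<open>exp (\<plusminus> \<i> t r\<^sup>3)\<close>, whose phase has derivative \<open>\<plusminus> 3 t r\<^sup>2\<close>, bounds the integral over \<open>[p, q]\<close> by
  a constant times \<open>1/p\<close>, uniformly in \<open>x\<close> (\<open>cubic_phase_integral_bound\<close>). The improper integrals
  therefore converge uniformly in \<open>x\<close>; the truncated integrals are continuous in \<open>x\<close>, hence so are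
  the limits (\<open>ray_integral_continuous\<close>).

  It remains to bound \<open>h\<close> and \<open>h'\<close>. On the real line \<open>h\<close> is the transform \<open>uhat u0\<close>. For complex
  \<open>k\<close>, this transform and its derivative are of size \<open>exp (max 0 (Im k))\<close>. On the rays of
  \<open>\<Gamma>\<^sup>\<plusminus>\<close> the growth is measured against \<open>Delta\<close>: the numbers \<open>Im w\<close>, \<open>Im (alpha w)\<close>,
  \<open>Im (alpha\<^sup>2 w)\<close> are \<open>0, \<plusminus>\<surd>3/2\<close> in some order, one exponential in \<open>Delta (w r)\<close>
  dominates, and \<open>\<bar>Delta (w r)\<bar> \<ge> cosh (\<surd>3 r/2) - 1\<close> for all \<open>r \<ge> 0\<close> (\<open>Delta_lower_bound\<close>). The
  numerator \<open>zeta_minus\<close> grows no faster. In \<open>zeta_plus\<close> the products that would grow like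
  \<open>exp (\<surd>3 r)\<close> cancel, and the rest is again of order \<open>exp (\<surd>3 r/2)\<close>. Near \<open>k = 0\<close>, both
  \<open>zeta_minus\<close> and \<open>Delta\<close> vanish to second order because \<open>1 + alpha + alpha\<^sup>2 = 0\<close>, and the zero of
  \<open>Delta\<close> has order exactly two, so the quotient extends continuously
  (\<open>zeta_minus_over_Delta_extends\<close>).
\<close>

section \<open>Improper oscillatory integrals with a cubic phase\<close>

text \<open>The tail bound makes the family Cauchy uniformly on \<open>X\<close>. The pointwise limit is found along the
  integers, and letting \<open>q \<rightarrow> \<infinity>\<close> in the hypothesis turns it into a rate of convergence.\<close>

lemma uniform_limit_at_top_of_tail_bound:
  fixes J :: "real \<Rightarrow> 'a \<Rightarrow> 'b::banach"
  assumes tail: "\<And>p q x. 1 \<le> p \<Longrightarrow> p \<le> q \<Longrightarrow> x \<in> X \<Longrightarrow> norm (J q x - J p x) \<le> C / p"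
  shows "\<exists>I. uniform_limit X J I at_top"
proof -
  have small: "\<forall>\<^sub>F p in at_top. C / p < e" if "e > 0" for e :: real
  proof -
    have "((\<lambda>p. C / p) \<longlongrightarrow> 0) at_top"
      by (intro tendsto_divide_0[OF tendsto_const] filterlim_at_top_imp_at_infinity filterlim_ident)
    then show ?thesis using that by (rule order_tendstoD)
  qed
  have "\<exists>l. (\<lambda>n. J (real (Suc n)) x) \<longlonglongrightarrow> l" if x: "x \<in> X" for x
  proof -
    have "Cauchy (\<lambda>n. J (real (Suc n)) x)"
    proof (rule CauchyI')
      fix e :: real assume "e > 0"
      then obtain N :: real where N: "\<And>p. p \<ge> N \<Longrightarrow> C / p < e"
        using small unfolding eventually_at_top_linorder by blast
      obtain M :: nat where M: "real M \<ge> N" using real_arch_simple by blast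
      have "dist (J (real (Suc m)) x) (J (real (Suc n)) x) < e" if "m \<ge> M" "n > m" for m n
      proof -
        have "norm (J (real (Suc n)) x - J (real (Suc m)) x) \<le> C / real (Suc m)"
          using that x by (intro tail) auto
        moreover have "C / real (Suc m) < e" using that M by (intro N) auto
        ultimately show ?thesis by (simp add: dist_norm norm_minus_commute)
      qed
      then show "\<exists>M. \<forall>m\<ge>M. \<forall>n>m. dist (J (real (Suc m)) x) (J (real (Suc n)) x) < e" by blast
    qed
    then show ?thesis by (simp add: convergent_eq_Cauchy)
  qed
  then obtain I where I: "\<And>x. x \<in> X \<Longrightarrow> (\<lambda>n. J (real (Suc n)) x) \<longlonglongrightarrow> I x" by metis
  have bound: "norm (I x - J p x) \<le> C / p" if "x \<in> X" "p \<ge> 1" for x p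
  proof -
    obtain M :: nat where "real M \<ge> p" using real_arch_simple by blast
    then have "\<forall>n\<ge>M. norm (J (real (Suc n)) x - J p x) \<le> C / p"
      using that by (auto intro!: tail)
    moreover have "(\<lambda>n. norm (J (real (Suc n)) x - J p x)) \<longlonglongrightarrow> norm (I x - J p x)"
      using that by (intro tendsto_intros I)
    ultimately show ?thesis by (rule Lim_bounded[rotated])
  qed
  have "uniform_limit X J I at_top"
  proof (rule uniform_limitI)
    fix e :: real assume "e > 0"
    show "\<forall>\<^sub>F p in at_top. \<forall>x\<in>X. dist (J p x) (I x) < e"
      using small[OF \<open>e > 0\<close>] eventually_ge_at_top[of 1]
    proof eventually_elim
      case (elim p)
      then show ?case using bound by (force simp: dist_norm norm_minus_commute)
    qed
  qed
  then show ?thesis by blast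
qed

text \<open>Integration by parts: with \<open>e(r) = exp (\<i> s r\<^sup>3 + c r)\<close>, the function
  \<open>P = e h / (3 \<i> s r\<^sup>2)\<close> has derivative \<open>e h + E\<close>, where \<open>E\<close> collects the terms in which the large
  factor \<open>3 \<i> s r\<^sup>2\<close> is not reproduced. Both \<open>P\<close> and \<open>E\<close> are \<open>O(1/r\<^sup>2)\<close>. The bound depends on \<open>c\<close>
  only through \<open>Re c \<le> 0\<close> and \<open>\<bar>c\<bar> \<le> 1\<close>, which gives uniformity in \<open>x\<close> later.\<close>

lemma cubic_phase_integral_bound:
  fixes h h' :: "real \<Rightarrow> complex" and c :: complex and s M p q :: real
  assumes s: "s \<noteq> 0" and c: "Re c \<le> 0" "norm c \<le> 1" and pq: "1 \<le> p" "p \<le> q"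
    and der: "\<And>r. r \<ge> 1 \<Longrightarrow> (h has_vector_derivative h' r) (at r within {1..})"
    and bd: "\<And>r. r \<ge> 1 \<Longrightarrow> norm (h r) \<le> M" "\<And>r. r \<ge> 1 \<Longrightarrow> norm (h' r) \<le> M"
  shows "norm (integral {p..q} (\<lambda>r. exp (\<i> * of_real s * of_real r ^ 3 + c * of_real r) * h r)) \<le> (2 * M / \<bar>s\<bar>) / p"
proof -
  define e where "e = (\<lambda>r::real. exp (\<i> * of_real s * of_real r ^ 3 + c * of_real r))"
  define P where "P = (\<lambda>r::real. e r * h r / (3 * \<i> * of_real s * of_real r ^ 2))"
  define E where "E = (\<lambda>r::real. e r * (c * h r + h' r - 2 * h r / of_real r) / (3 * \<i> * of_real s * of_real r ^ 2))"
  have M: "M \<ge> 0" using bd(1)[of 1] norm_ge_zero[of "h 1"] by linarith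
  have norm_e: "norm (e r) \<le> 1" if "r \<ge> 0" for r
  proof -
    have "Im (complex_of_real r ^ 3) = 0" by (simp flip: of_real_power)
    then show ?thesis using c that by (simp add: e_def mult_nonpos_nonneg)
  qed
  have e_der: "(e has_vector_derivative (3 * \<i> * of_real s * of_real r ^ 2 + c) * e r) (at r within S)" for r S
  proof -
    have "((\<lambda>z. exp (\<i> * of_real s * z ^ 3 + c * z)) has_field_derivative
        (3 * \<i> * of_real s * of_real r ^ 2 + c) * e r) (at (complex_of_real r))"
      unfolding e_def by (rule derivative_eq_intros refl | simp add: algebra_simps)+
    from has_vector_derivative_real_field[OF this] show ?thesis by (simp add: e_def o_def)
  qed
  have inv_der: "((\<lambda>r. 1 / (3 * \<i> * of_real s * of_real r ^ 2)) has_vector_derivative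
        - 2 / (3 * \<i> * of_real s * of_real r ^ 3)) (at r within S)" if "r \<ge> 1" for r :: real and S
  proof -
    have "((\<lambda>z. 1 / (3 * \<i> * of_real s * z ^ 2)) has_field_derivative
        - 2 / (3 * \<i> * of_real s * of_real r ^ 3)) (at (complex_of_real r))"
      using that s
      by (auto intro!: derivative_eq_intros simp: field_simps power2_eq_square power3_eq_cube)
    from has_vector_derivative_real_field[OF this] show ?thesis by (simp add: o_def)
  qed
  have P_der: "(P has_vector_derivative e r * h r + E r) (at r within {p..q})" if "r \<in> {p..q}" for r
  proof -
    have r: "r \<ge> 1" using that pq by simp
    have hd: "(h has_vector_derivative h' r) (at r within {p..q})"
      by (rule has_vector_derivative_within_subset[OF der[OF r]]) (use pq in auto)
    have "((\<lambda>r. e r * h r * (1 / (3 * \<i> * of_real s * of_real r ^ 2))) has_vector_derivative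
       (e r * h r * (- 2 / (3 * \<i> * of_real s * of_real r ^ 3)) +
        (e r * h' r + (3 * \<i> * of_real s * of_real r ^ 2 + c) * e r * h r) * (1 / (3 * \<i> * of_real s * of_real r ^ 2))))
       (at r within {p..q})"
      by (intro has_vector_derivative_mult e_der hd inv_der r)
    also have "(e r * h r * (- 2 / (3 * \<i> * of_real s * of_real r ^ 3)) +
        (e r * h' r + (3 * \<i> * of_real s * of_real r ^ 2 + c) * e r * h r) * (1 / (3 * \<i> * of_real s * of_real r ^ 2))) = e r * h r + E r"
      using r s by (simp add: E_def field_simps power2_eq_square power3_eq_cube)
    finally show ?thesis by (simp add: P_def)
  qed
  have int_P: "((\<lambda>r. e r * h r + E r) has_integral (P q - P p)) {p..q}"
    by (rule fundamental_theorem_of_calculus[OF pq(2) P_der])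
  have cont_h: "continuous_on {p..q} h"
    by (rule continuous_on_vector_derivative, rule has_vector_derivative_within_subset[OF der])
      (use pq in auto)
  have int_eh: "(\<lambda>r. e r * h r) integrable_on {p..q}"
    unfolding e_def by (intro integrable_continuous_real continuous_intros cont_h)
  \<comment> \<open>As \<open>h'\<close> may be discontinuous, \<open>E\<close> is integrated as the difference of \<open>P'\<close> and \<open>e h\<close>.\<close>
  have int_E: "E integrable_on {p..q}"
    using integrable_diff[OF has_integral_integrable[OF int_P] int_eh] by simp
  have bound_E: "norm (E r) \<le> (4 * M / (3 * \<bar>s\<bar>)) * (1 / r ^ 2)" if "r \<in> {p..q}" for r
  proof -
    have r: "r \<ge> 1" using that pq by simp
    have "norm (c * h r + h' r - 2 * h r / of_real r) \<le> norm (c * h r) + norm (h' r) + norm (2 * h r / of_real r)"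
      by (rule order_trans[OF norm_triangle_ineq4]) (intro add_right_mono norm_triangle_ineq)
    also have "\<dots> \<le> M + M + 2 * M"
    proof (intro add_mono)
      show "norm (c * h r) \<le> M"
        using mult_mono[OF c(2) bd(1)[OF r]] by (simp add: norm_mult)
      show "norm (h' r) \<le> M" by (rule bd(2)[OF r])
      have "norm (2 * h r / of_real r) = 2 * norm (h r) / r" using r by (simp add: norm_mult norm_divide)
      also have "\<dots> \<le> 2 * norm (h r) / 1" using r by (intro divide_left_mono) auto
      also have "\<dots> \<le> 2 * M" using bd(1)[OF r] by simp
      finally show "norm (2 * h r / of_real r) \<le> 2 * M" .
    qed
    finally have "norm (e r) * norm (c * h r + h' r - 2 * h r / of_real r) \<le> 1 * (4 * M)"
      using norm_e[of r] r by (intro mult_mono) auto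
    then have "norm (e r) * norm (c * h r + h' r - 2 * h r / of_real r) / (3 * \<bar>s\<bar> * r ^ 2)
       \<le> 4 * M / (3 * \<bar>s\<bar> * r ^ 2)"
      by (intro divide_right_mono) auto
    then show ?thesis by (simp add: E_def norm_mult norm_divide norm_power)
  qed
  have int_sq: "((\<lambda>r. 1 / r ^ 2) has_integral (- 1 / q - - 1 / p)) {p..q}"
  proof (rule fundamental_theorem_of_calculus[OF pq(2)])
    fix r assume "r \<in> {p..q}"
    then have "r \<noteq> 0" using pq by auto
    then show "((\<lambda>r. - 1 / r) has_vector_derivative 1 / r ^ 2) (at r within {p..q})"
      unfolding has_real_derivative_iff_has_vector_derivative[symmetric]
      by (auto intro!: derivative_eq_intros simp: power2_eq_square)
  qed
  have "norm (integral {p..q} E) \<le> integral {p..q} (\<lambda>r. (4 * M / (3 * \<bar>s\<bar>)) * (1 / r ^ 2))"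
    using int_sq by (intro integral_norm_bound_integral int_E bound_E integrable_on_mult_right)
       (auto simp: has_integral_integrable)
  also have "\<dots> = (4 * M / (3 * \<bar>s\<bar>)) * (1 / p - 1 / q)"
    by (rule trans[OF integral_unique[OF has_integral_mult_right[OF int_sq]]]) simp
  finally have B1: "norm (integral {p..q} E) \<le> (4 * M / (3 * \<bar>s\<bar>)) * (1 / p - 1 / q)" .
  have B2: "norm (P r) \<le> M / (3 * \<bar>s\<bar>) * (1 / r)" if "r \<ge> 1" for r
  proof -
    have "norm (e r) * norm (h r) \<le> 1 * M"
      using norm_e[of r] bd(1)[of r] that by (intro mult_mono) auto
    then have "norm (P r) \<le> M / (3 * \<bar>s\<bar> * r ^ 2)"
      by (simp add: P_def norm_mult norm_divide norm_power divide_right_mono)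
    also have "\<dots> \<le> M / (3 * \<bar>s\<bar> * r)"
      using that s M by (intro divide_left_mono mult_left_mono mult_pos_pos) (auto simp: power2_eq_square)
    finally show ?thesis by simp
  qed
  have "integral {p..q} (\<lambda>r. e r * h r) = P q - P p - integral {p..q} E"
    using integral_unique[OF int_P] integral_add[OF int_eh int_E] by (simp add: algebra_simps)
  then have "norm (integral {p..q} (\<lambda>r. e r * h r)) \<le> norm (P q) + norm (P p) + norm (integral {p..q} E)"
    by (metis add_right_mono norm_triangle_ineq4 order_trans)
  also have "\<dots> \<le> M / (3 * \<bar>s\<bar>) * (1 / q) + M / (3 * \<bar>s\<bar>) * (1 / p) + (4 * M / (3 * \<bar>s\<bar>)) * (1 / p - 1 / q)"
    using pq by (intro add_mono B1 B2) auto
  also have "\<dots> = (2 * M / \<bar>s\<bar>) / p - (M / \<bar>s\<bar> / q + M / (3 * \<bar>s\<bar>) / p)"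
    using s pq by (simp add: field_simps)
  also have "\<dots> \<le> (2 * M / \<bar>s\<bar>) / p"
  proof -
    have "0 \<le> M / \<bar>s\<bar> / q" "0 \<le> M / (3 * \<bar>s\<bar>) / p" using M pq by auto
    then show ?thesis by linarith
  qed
  finally show ?thesis by (simp add: e_def)
qed

section \<open>Exponential order\<close>

text \<open>The derivative is one-sided at \<open>1\<close>, so that only the values on \<open>{1..}\<close> matter. Controlling \<open>f\<close> and
  \<open>f'\<close> with the same exponent makes the notion stable under products and quotients, with exponents
  adding and subtracting; order \<open>0\<close> is the hypothesis of the oscillatory estimate.\<close>

definition C1_exp_order :: "real \<Rightarrow> (real \<Rightarrow> complex) \<Rightarrow> bool" where
  "C1_exp_order c f \<longleftrightarrow> (\<exists>f' M. \<forall>r\<ge>1. (f has_vector_derivative f' r) (at r within {1..}) \<and>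
     norm (f r) \<le> M * exp (c * r) \<and> norm (f' r) \<le> M * exp (c * r))"

lemma C1_exp_orderI:
  assumes "\<And>r. r \<ge> 1 \<Longrightarrow> (f has_vector_derivative f' r) (at r within {1..})"
    "\<And>r. r \<ge> 1 \<Longrightarrow> norm (f r) \<le> M * exp (c * r)" "\<And>r. r \<ge> 1 \<Longrightarrow> norm (f' r) \<le> M * exp (c * r)"
  shows "C1_exp_order c f"
  unfolding C1_exp_order_def using assms by (intro exI[of _ f'] exI[of _ M]) simp

lemma C1_exp_orderE:
  assumes "C1_exp_order c f"
  obtains f' M where "M \<ge> 0" "\<And>r. r \<ge> 1 \<Longrightarrow> (f has_vector_derivative f' r) (at r within {1..})"
    "\<And>r. r \<ge> 1 \<Longrightarrow> norm (f r) \<le> M * exp (c * r)" "\<And>r. r \<ge> 1 \<Longrightarrow> norm (f' r) \<le> M * exp (c * r)"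
proof -
  obtain f' M where *: "\<forall>r\<ge>1. (f has_vector_derivative f' r) (at r within {1..}) \<and>
     norm (f r) \<le> M * exp (c * r) \<and> norm (f' r) \<le> M * exp (c * r)"
    using assms unfolding C1_exp_order_def by blast
  then have "norm (f 1) \<le> M * exp (c * 1)" by blast
  then have "0 \<le> M * exp (c * 1)" using norm_ge_zero order_trans by blast
  then have "M \<ge> 0" by (simp add: zero_le_mult_iff)
  then show ?thesis using * that[of M f'] by blast
qed

lemma C1_exp_order_cong:
  assumes "\<And>r. r \<ge> 1 \<Longrightarrow> f r = g r"
  shows "C1_exp_order c f \<longleftrightarrow> C1_exp_order c g"
proof -
  have "(f has_vector_derivative d) (at r within {1..}) \<longleftrightarrow> (g has_vector_derivative d) (at r within {1..})"
    if "r \<ge> 1" for r d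
    using assms that by (intro has_vector_derivative_cong_ev) (auto intro!: always_eventually)
  then show ?thesis unfolding C1_exp_order_def using assms by (smt (verit, best))
qed

lemma C1_exp_order_mono:
  assumes "C1_exp_order c f" "c \<le> d"
  shows "C1_exp_order d f"
  using assms(1)
proof (rule C1_exp_orderE)
  fix f' and M :: real
  assume M: "M \<ge> 0" and f: "\<And>r. r \<ge> 1 \<Longrightarrow> (f has_vector_derivative f' r) (at r within {1..})"
    "\<And>r. r \<ge> 1 \<Longrightarrow> norm (f r) \<le> M * exp (c * r)" "\<And>r. r \<ge> 1 \<Longrightarrow> norm (f' r) \<le> M * exp (c * r)"
  have "M * exp (c * r) \<le> M * exp (d * r)" if "r \<ge> 1" for r
    using M assms(2) that by (intro mult_left_mono) auto
  then show ?thesis unfolding C1_exp_order_def using f by (meson order_trans)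
qed

lemma C1_exp_order_add:
  assumes "C1_exp_order c f" "C1_exp_order c g"
  shows "C1_exp_order c (\<lambda>r. f r + g r)"
proof -
  obtain f' M where f: "\<And>r. r \<ge> 1 \<Longrightarrow> (f has_vector_derivative f' r) (at r within {1..})"
    "\<And>r. r \<ge> 1 \<Longrightarrow> norm (f r) \<le> M * exp (c * r)" "\<And>r. r \<ge> 1 \<Longrightarrow> norm (f' r) \<le> M * exp (c * r)"
    using assms(1) by (rule C1_exp_orderE) blast
  obtain g' N where g: "\<And>r. r \<ge> 1 \<Longrightarrow> (g has_vector_derivative g' r) (at r within {1..})"
    "\<And>r. r \<ge> 1 \<Longrightarrow> norm (g r) \<le> N * exp (c * r)" "\<And>r. r \<ge> 1 \<Longrightarrow> norm (g' r) \<le> N * exp (c * r)"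
    using assms(2) by (rule C1_exp_orderE) blast
  have "((\<lambda>r. f r + g r) has_vector_derivative f' r + g' r) (at r within {1..})"
    "norm (f r + g r) \<le> (M + N) * exp (c * r)" "norm (f' r + g' r) \<le> (M + N) * exp (c * r)"
    if "r \<ge> 1" for r
    using has_vector_derivative_add[OF f(1) g(1)] norm_triangle_mono[OF f(2) g(2)]
      norm_triangle_mono[OF f(3) g(3)] that by (simp_all add: ring_distribs)
  then show ?thesis by (rule C1_exp_orderI)
qed

lemma C1_exp_order_mult:
  assumes "C1_exp_order c f" "C1_exp_order d g"
  shows "C1_exp_order (c + d) (\<lambda>r. f r * g r)"
proof -
  obtain f' M where M: "M \<ge> 0" and f: "\<And>r. r \<ge> 1 \<Longrightarrow> (f has_vector_derivative f' r) (at r within {1..})"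
    "\<And>r. r \<ge> 1 \<Longrightarrow> norm (f r) \<le> M * exp (c * r)" "\<And>r. r \<ge> 1 \<Longrightarrow> norm (f' r) \<le> M * exp (c * r)"
    using assms(1) by (rule C1_exp_orderE) blast
  obtain g' N where N: "N \<ge> 0" and g: "\<And>r. r \<ge> 1 \<Longrightarrow> (g has_vector_derivative g' r) (at r within {1..})"
    "\<And>r. r \<ge> 1 \<Longrightarrow> norm (g r) \<le> N * exp (d * r)" "\<And>r. r \<ge> 1 \<Longrightarrow> norm (g' r) \<le> N * exp (d * r)"
    using assms(2) by (rule C1_exp_orderE) blast
  have prod: "norm (a * b) \<le> M * N * exp ((c + d) * r)"
    if "norm a \<le> M * exp (c * r)" "norm b \<le> N * exp (d * r)" for a b :: complex and r
    using mult_mono[OF that] M N by (simp add: norm_mult exp_add ring_distribs mult_ac)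
  have "norm (f r * g r) \<le> 2 * M * N * exp ((c + d) * r)" if "r \<ge> 1" for r
  proof -
    have "0 \<le> M * N * exp ((c + d) * r)" using M N by simp
    then show ?thesis using prod[OF f(2)[OF that] g(2)[OF that]] by linarith
  qed
  moreover have "norm (f r * g' r + f' r * g r) \<le> 2 * M * N * exp ((c + d) * r)" if "r \<ge> 1" for r
    using norm_triangle_mono[OF prod[OF f(2)[OF that] g(3)[OF that]] prod[OF f(3)[OF that] g(2)[OF that]]]
    by simp
  moreover have "((\<lambda>r. f r * g r) has_vector_derivative f r * g' r + f' r * g r) (at r within {1..})"
    if "r \<ge> 1" for r
    using that by (intro has_vector_derivative_mult f g)
  ultimately show ?thesis by (intro C1_exp_orderI)
qed

lemma C1_exp_order_const: "C1_exp_order 0 (\<lambda>_. a)"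
  by (rule C1_exp_orderI[where f' = "\<lambda>_. 0" and M = "norm a"]) (auto intro!: derivative_eq_intros)

lemma C1_exp_order_cmult: "C1_exp_order c f \<Longrightarrow> C1_exp_order c (\<lambda>r. a * f r)"
  using C1_exp_order_mult[OF C1_exp_order_const[of a], of c f] by simp

lemma C1_exp_order_diff:
  assumes "C1_exp_order c f" "C1_exp_order c g"
  shows "C1_exp_order c (\<lambda>r. f r - g r)"
  using C1_exp_order_add[OF assms(1) C1_exp_order_cmult[OF assms(2), of "-1"]] by simp

lemma C1_exp_order_exp: "C1_exp_order (Re v) (\<lambda>r. exp (v * of_real r))"
proof -
  have "((\<lambda>r. exp (v * of_real r)) has_vector_derivative v * exp (v * of_real r)) (at r within {1..})"
    for r :: real
  proof -
    have "((\<lambda>z. exp (v * z)) has_field_derivative v * exp (v * of_real r)) (at (complex_of_real r))"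
      by (auto intro!: derivative_eq_intros)
    from has_vector_derivative_real_field[OF this] show ?thesis by (simp add: o_def)
  qed
  then show ?thesis unfolding C1_exp_order_def
    by (intro exI[of _ "\<lambda>r. v * exp (v * of_real r)"] exI[of _ "1 + norm v"])
      (auto simp: norm_mult ring_distribs)
qed

lemma C1_exp_order_inverse:
  assumes "C1_exp_order d g" "m > 0" and low: "\<And>r. r \<ge> 1 \<Longrightarrow> norm (g r) \<ge> m * exp (d * r)"
  shows "C1_exp_order (- d) (\<lambda>r. inverse (g r))"
proof -
  obtain g' N where N: "N \<ge> 0" and g: "\<And>r. r \<ge> 1 \<Longrightarrow> (g has_vector_derivative g' r) (at r within {1..})"
    "\<And>r. r \<ge> 1 \<Longrightarrow> norm (g r) \<le> N * exp (d * r)" "\<And>r. r \<ge> 1 \<Longrightarrow> norm (g' r) \<le> N * exp (d * r)"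
    using assms(1) by (rule C1_exp_orderE) blast
  have "((\<lambda>r. inverse (g r)) has_vector_derivative - (inverse (g r) * g' r * inverse (g r))) (at r within {1..})"
    if "r \<ge> 1" for r
  proof -
    have pos: "0 < m * exp (d * r)" using assms(2) by simp
    have "norm (g r) > 0" using low[OF that] pos by (rule order.strict_trans2[rotated])
    then have "g r \<noteq> 0" by simp
    then have "((\<lambda>r. inverse (g r)) has_derivative (\<lambda>h. - (inverse (g r) * (h *\<^sub>R g' r) * inverse (g r))))
        (at r within {1..})"
      using g(1)[OF that] unfolding has_vector_derivative_def by (rule Deriv.has_derivative_inverse)
    then show ?thesis by (simp add: has_vector_derivative_def)
  qed
  moreover have inv: "norm (inverse (g r)) \<le> (1 / m) * exp (- d * r)" if "r \<ge> 1" for r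
  proof -
    have "norm (inverse (g r)) \<le> inverse (m * exp (d * r))"
      unfolding norm_inverse using assms(2) low[OF that] by (intro le_imp_inverse_le) auto
    then show ?thesis by (simp add: exp_minus inverse_eq_divide)
  qed
  have "norm (inverse (g r)) \<le> (1 / m + N / m\<^sup>2) * exp (- d * r)" if "r \<ge> 1" for r
    by (rule order_trans[OF inv[OF that]]) (use N in \<open>intro mult_right_mono, auto\<close>)
  moreover have "norm (- (inverse (g r) * g' r * inverse (g r))) \<le> (1 / m + N / m\<^sup>2) * exp (- d * r)"
    if "r \<ge> 1" for r
  proof -
    have "norm (- (inverse (g r) * g' r * inverse (g r))) =
        norm (inverse (g r)) * norm (g' r) * norm (inverse (g r))" by (simp add: norm_mult)
    also have "\<dots> \<le> (1 / m) * exp (- d * r) * (N * exp (d * r)) * ((1 / m) * exp (- d * r))"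
      using N assms(2) by (intro mult_mono inv g(3) that) auto
    also have "\<dots> = N / m\<^sup>2 * exp (- d * r)"
      by (simp add: exp_minus power2_eq_square)
    also have "\<dots> \<le> (1 / m + N / m\<^sup>2) * exp (- d * r)"
      using assms(2) by (intro mult_right_mono) auto
    finally show ?thesis .
  qed
  ultimately show ?thesis by (intro C1_exp_orderI)
qed

lemma C1_exp_order_divide:
  assumes "C1_exp_order c f" "C1_exp_order c g" "m > 0" "\<And>r. r \<ge> 1 \<Longrightarrow> norm (g r) \<ge> m * exp (c * r)"
  shows "C1_exp_order 0 (\<lambda>r. f r / g r)"
  using C1_exp_order_mult[OF assms(1) C1_exp_order_inverse[OF assms(2-4)]] by (simp add: divide_inverse)

section \<open>Half-lines and rays\<close>

text \<open>Continuity of \<open>h\<close> up to \<open>0\<close> gives continuity in \<open>x\<close> of the truncated integrals, and exponential order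
  \<open>0\<close> gives their uniform convergence. The formula for \<open>F\<close> is required only for \<open>r > 0\<close>, as the
  integrands along \<open>\<Gamma>\<^sup>\<plusminus>\<close> take a conventional value at the removable singularity.\<close>

lemma half_line_integral:
  fixes F :: "'a::topological_space \<Rightarrow> real \<Rightarrow> complex"
  assumes h: "C1_exp_order 0 h" "continuous_on {0..} h" and s: "s \<noteq> 0"
    and c: "\<And>x. x \<in> X \<Longrightarrow> Re (c x) \<le> 0" "\<And>x. x \<in> X \<Longrightarrow> norm (c x) \<le> 1" "continuous_on X c"
    and F: "\<And>x r. x \<in> X \<Longrightarrow> r > 0 \<Longrightarrow> F x r = exp (\<i> * of_real s * of_real r ^ 3 + c x * of_real r) * h r"
  obtains I where "continuous_on X I" "\<And>x. x \<in> X \<Longrightarrow> ((\<lambda>R. integral {0..R} (F x)) \<longlongrightarrow> I x) at_top"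
    "\<And>x R. x \<in> X \<Longrightarrow> F x integrable_on {0..R}"
proof -
  define A where "A = (\<lambda>x r. exp (\<i> * of_real s * of_real r ^ 3 + c x * of_real r) * h r)"
  have contA: "continuous_on {0..R} (A x)" for x R
    unfolding A_def by (intro continuous_intros continuous_on_subset[OF h(2)]) auto
  have spike: "integral {0..R} (F x) = integral {0..R} (A x)" if "x \<in> X" for x R
    using F[OF that] by (intro integral_spike[where S = "{0}"]) (auto simp: A_def)
  have intA: "A x integrable_on {0..R}" for x R
    using contA by (rule integrable_continuous_real)
  have intF: "F x integrable_on {0..R}" if "x \<in> X" for x R
    using F[OF that] by (intro integrable_spike[OF intA[of x R], where S = "{0}"]) (auto simp: A_def)
  obtain h' M where hd: "\<And>r. r \<ge> 1 \<Longrightarrow> (h has_vector_derivative h' r) (at r within {1..})"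
    "\<And>r. r \<ge> 1 \<Longrightarrow> norm (h r) \<le> M * exp (0 * r)" "\<And>r. r \<ge> 1 \<Longrightarrow> norm (h' r) \<le> M * exp (0 * r)"
    using h(1) by (rule C1_exp_orderE) blast
  have "\<exists>I. uniform_limit X (\<lambda>R x. integral {0..R} (A x)) I at_top"
  proof (rule uniform_limit_at_top_of_tail_bound)
    fix p q x assume pq: "1 \<le> p" "p \<le> (q::real)" and x: "x \<in> X"
    have "integral {0..p} (A x) + integral {p..q} (A x) = integral {0..q} (A x)"
      using pq by (intro Henstock_Kurzweil_Integration.integral_combine intA) auto
    then have "integral {0..q} (A x) - integral {0..p} (A x) = integral {p..q} (A x)"
      by (simp add: algebra_simps)
    then show "norm (integral {0..q} (A x) - integral {0..p} (A x)) \<le> (2 * M / \<bar>s\<bar>) / p"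
      using cubic_phase_integral_bound[OF s c(1)[OF x] c(2)[OF x] pq hd(1), of M] hd(2,3)
      by (simp add: A_def)
  qed
  then obtain I where I: "uniform_limit X (\<lambda>R x. integral {0..R} (A x)) I at_top" ..
  have "continuous_on X (\<lambda>x. integral (cbox 0 R) (A x))" for R
  proof (rule integral_continuous_on_param)
    have "continuous_on (X \<times> cbox 0 R) (\<lambda>z. exp (\<i> * of_real s * of_real (snd z) ^ 3
        + c (fst z) * of_real (snd z)) * h (snd z))"
      by (intro continuous_intros continuous_on_compose2[OF c(3)] continuous_on_compose2[OF h(2)]) auto
    then show "continuous_on (X \<times> cbox 0 R) (\<lambda>(x, r). A x r)"
      by (simp add: A_def split_beta')
  qed
  then have "continuous_on X I"
    by (intro uniform_limit_theorem[OF _ I]) (auto intro!: always_eventually)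
  moreover have "((\<lambda>R. integral {0..R} (F x)) \<longlongrightarrow> I x) at_top" if "x \<in> X" for x
    using tendsto_uniform_limitI[OF I that] spike[OF that] by simp
  ultimately show ?thesis using that intF by blast
qed

lemma contour_integral_ray:
  assumes "R > 0" "(\<lambda>r. f (rcis r \<theta>)) integrable_on {0..R}"
  shows "(f has_contour_integral cis \<theta> * integral {0..R} (\<lambda>r. f (rcis r \<theta>))) (linepath 0 (rcis R \<theta>))"
proof -
  let ?J = "integral {0..R} (\<lambda>r. f (rcis r \<theta>))"
  have "((\<lambda>x. f (rcis (R * x) \<theta>)) has_integral (1 / \<bar>R\<bar>) *\<^sub>R ?J) ((\<lambda>x. x / R) ` {0..R})"
    using assms by (intro has_integral_stretch_real) (auto simp: integrable_integral)
  moreover have "(\<lambda>x. x / R) ` {0..R} = {0..1}"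
    using assms(1) image_divide_atLeastAtMost[of R 0 R] by simp
  ultimately have "((\<lambda>x. f (rcis (R * x) \<theta>) * rcis R \<theta>) has_integral (1 / \<bar>R\<bar>) *\<^sub>R ?J * rcis R \<theta>) {0..1}"
    by (metis has_integral_mult_left)
  moreover have "(1 / \<bar>R\<bar>) *\<^sub>R ?J * rcis R \<theta> = cis \<theta> * ?J"
    using assms(1) by (simp add: rcis_def scaleR_conv_of_real)
  moreover have "linepath 0 (rcis R \<theta>) x = rcis (R * x) \<theta>" for x
    by (simp add: linepath_def rcis_def scaleR_conv_of_real)
  ultimately show ?thesis by (simp add: has_contour_integral_linepath)
qed

lemma ray_integral_continuous:
  fixes F :: "'a::topological_space \<Rightarrow> complex \<Rightarrow> complex"
  assumes h: "C1_exp_order 0 h" "continuous_on {0..} h" and s: "s \<noteq> 0"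
    and c: "\<And>x. x \<in> X \<Longrightarrow> Re (c x) \<le> 0" "\<And>x. x \<in> X \<Longrightarrow> norm (c x) \<le> 1" "continuous_on X c"
    and F: "\<And>x r. x \<in> X \<Longrightarrow> r > 0 \<Longrightarrow>
        F x (rcis r \<theta>) = exp (\<i> * of_real s * of_real r ^ 3 + c x * of_real r) * h r"
  shows "\<forall>x\<in>X. ray_integrable \<theta> (F x)" "continuous_on X (\<lambda>x. ray_integral \<theta> (F x))"
proof -
  obtain I where I: "continuous_on X I"
    "\<And>x. x \<in> X \<Longrightarrow> ((\<lambda>R. integral {0..R} (\<lambda>r. F x (rcis r \<theta>))) \<longlongrightarrow> I x) at_top"
    "\<And>x R. x \<in> X \<Longrightarrow> (\<lambda>r. F x (rcis r \<theta>)) integrable_on {0..R}"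
    by (rule half_line_integral[OF h s c, of "\<lambda>x r. F x (rcis r \<theta>)"]) (use F in auto)
  have lim: "((\<lambda>R. contour_integral (linepath 0 (rcis R \<theta>)) (F x)) \<longlongrightarrow> cis \<theta> * I x) at_top"
    if "x \<in> X" for x
  proof (rule Lim_transform_eventually)
    show "((\<lambda>R. cis \<theta> * integral {0..R} (\<lambda>r. F x (rcis r \<theta>))) \<longlongrightarrow> cis \<theta> * I x) at_top"
      by (intro tendsto_intros I that)
    show "\<forall>\<^sub>F R in at_top. cis \<theta> * integral {0..R} (\<lambda>r. F x (rcis r \<theta>)) =
        contour_integral (linepath 0 (rcis R \<theta>)) (F x)"
      using eventually_gt_at_top[of 0]
      by eventually_elim (metis contour_integral_ray contour_integral_unique I(3) that)
  qed
  show "\<forall>x\<in>X. ray_integrable \<theta> (F x)"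
    unfolding ray_integrable_def using lim contour_integral_ray I(3)
    by (metis has_contour_integral_integrable)
  have "ray_integral \<theta> (F x) = cis \<theta> * I x" if "x \<in> X" for x
    unfolding ray_integral_def by (rule tendsto_Lim) (use lim that in auto)
  then show "continuous_on X (\<lambda>x. ray_integral \<theta> (F x))"
    by (subst continuous_on_cong[OF refl]) (auto intro!: continuous_intros I)
qed

text \<open>Once \<open>a \<le> 0 \<le> b\<close>, the integral over \<open>[a, b]\<close> is a sum of one term depending on \<open>b\<close> and one depending
  on \<open>a\<close>; this is why the two endpoints may tend to infinity independently.\<close>

lemma improper_integral_of_half_lines:
  assumes pos: "\<And>R. f integrable_on {0..R}" "((\<lambda>R. integral {0..R} f) \<longlongrightarrow> I) at_top"
    and neg: "\<And>R. (\<lambda>r. f (- r)) integrable_on {0..R}" "((\<lambda>R. integral {0..R} (\<lambda>r. f (- r))) \<longlongrightarrow> J) at_top"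
  shows "improper_integrable f" "improper_integral f = I + J"
proof -
  have neg_int: "f integrable_on {- R..0}" for R
    using Henstock_Kurzweil_Integration.integrable_reflect_real[where f = f and a = "- R" and b = 0] neg(1)[of R] by simp
  have int0: "f integrable_on {a..b}" if "a \<le> 0" "0 \<le> b" for a b
    using Henstock_Kurzweil_Integration.integrable_combine[OF that, of f] neg_int[of "- a"] pos(1)[of b] by simp
  have int: "f integrable_on {a..b}" for a b
    by (rule integrable_subinterval_real[OF int0[of "min a 0" "max b 0"]]) auto
  have split: "integral {a..b} f = integral {0..b} f + integral {0..- a} (\<lambda>r. f (- r))"
    if "a \<le> 0" "0 \<le> b" for a b
  proof -
    have "integral {a..b} f = integral {a..0} f + integral {0..b} f"
      using Henstock_Kurzweil_Integration.integral_combine[OF that int] by simp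
    then show ?thesis
      using Henstock_Kurzweil_Integration.integral_reflect_real[where f = f and a = a and b = 0] by simp
  qed
  have lim: "((\<lambda>(a, b). integral {a..b} f) \<longlongrightarrow> I + J) (at_bot \<times>\<^sub>F at_top)"
  proof (rule Lim_transform_eventually)
    have "((\<lambda>z. integral {0..snd z} f) \<longlongrightarrow> I) (at_bot \<times>\<^sub>F (at_top :: real filter))"
      by (rule filterlim_compose[OF pos(2) filterlim_snd])
    moreover have "filterlim (\<lambda>z. - fst z :: real) at_top (at_bot \<times>\<^sub>F (at_top :: real filter))"
      by (rule filterlim_compose[OF filterlim_uminus_at_top_at_bot filterlim_fst])
    then have "((\<lambda>z. integral {0..- fst z} (\<lambda>r. f (- r))) \<longlongrightarrow> J) (at_bot \<times>\<^sub>F (at_top :: real filter))"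
      by (rule filterlim_compose[OF neg(2)])
    ultimately show "((\<lambda>z. integral {0..snd z} f + integral {0..- fst z} (\<lambda>r. f (- r))) \<longlongrightarrow> I + J)
        (at_bot \<times>\<^sub>F (at_top :: real filter))"
      by (intro tendsto_add)
    have "\<forall>\<^sub>F z in at_bot \<times>\<^sub>F (at_top :: real filter). fst z \<le> (0::real) \<and> 0 \<le> snd z"
      by (rule eventually_prodI[OF eventually_le_at_bot eventually_ge_at_top, of 0 0, THEN eventually_mono]) auto
    then show "\<forall>\<^sub>F z in at_bot \<times>\<^sub>F at_top. integral {0..snd z} f + integral {0..- fst z} (\<lambda>r. f (- r)) =
        (case z of (a, b) \<Rightarrow> integral {a..b} f)"
    proof eventually_elim
      case (elim z)
      then show ?case using split[of "fst z" "snd z"] by (simp add: case_prod_beta)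
    qed
  qed
  show "improper_integrable f" unfolding improper_integrable_def using int lim by blast
  show "improper_integral f = I + J" unfolding improper_integral_def
    by (rule tendsto_Lim[OF _ lim]) (simp add: prod_filter_eq_bot)
qed

section \<open>The finite Fourier transform\<close>

text \<open>The indicator \<open>max 0 (Im k)\<close> is that of the transform of a function supported in \<open>[0, 1]\<close>, for which
  \<open>\<bar>exp (- \<i> k x)\<bar> = exp (x Im k)\<close> with \<open>0 \<le> x \<le> 1\<close>. The derivative is the transform of
  \<open>- \<i> x u0(x)\<close> and obeys the same bound.\<close>

definition entire_of_exp_type :: "(complex \<Rightarrow> complex) \<Rightarrow> bool" where
  "entire_of_exp_type U \<longleftrightarrow> (\<exists>U' M. \<forall>k. (U has_field_derivative U' k) (at k) \<and>
     norm (U k) \<le> M * exp (max 0 (Im k)) \<and> norm (U' k) \<le> M * exp (max 0 (Im k)))"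

lemma entire_of_exp_type_0: "entire_of_exp_type (\<lambda>_. 0)"
  unfolding entire_of_exp_type_def by (intro exI[of _ "\<lambda>_. 0"] exI[of _ 0]) auto

lemma entire_of_exp_type_add:
  assumes "entire_of_exp_type U" "entire_of_exp_type V"
  shows "entire_of_exp_type (\<lambda>k. U k + V k)"
proof -
  obtain U' M where U: "\<And>k. (U has_field_derivative U' k) (at k)"
     "\<And>k. norm (U k) \<le> M * exp (max 0 (Im k))" "\<And>k. norm (U' k) \<le> M * exp (max 0 (Im k))"
    using assms(1) unfolding entire_of_exp_type_def by blast
  obtain V' N where V: "\<And>k. (V has_field_derivative V' k) (at k)"
     "\<And>k. norm (V k) \<le> N * exp (max 0 (Im k))" "\<And>k. norm (V' k) \<le> N * exp (max 0 (Im k))"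
    using assms(2) unfolding entire_of_exp_type_def by blast
  show ?thesis unfolding entire_of_exp_type_def
    using DERIV_add[OF U(1) V(1)] norm_triangle_mono[OF U(2) V(2)] norm_triangle_mono[OF U(3) V(3)]
    by (intro exI[of _ "\<lambda>k. U' k + V' k"] exI[of _ "M + N"]) (simp add: distrib_right)
qed

lemma entire_of_exp_type_fourier:
  assumes g: "continuous_on {a..b} g" and ab: "0 \<le> a" "a \<le> b" "b \<le> 1"
  shows "entire_of_exp_type (\<lambda>k. integral {a..b} (\<lambda>x. exp (- \<i> * k * of_real x) * g x))"
proof -
  obtain B where B: "B \<ge> 0" "\<And>x. x \<in> {a..b} \<Longrightarrow> norm (g x) \<le> B"
    using continuous_on_compact_bound[OF _ g] by auto
  define U' where "U' = (\<lambda>k. integral {a..b} (\<lambda>x. - \<i> * of_real x * exp (- \<i> * k * of_real x) * g x))"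
  have der: "((\<lambda>k. integral {a..b} (\<lambda>x. exp (- \<i> * k * of_real x) * g x)) has_field_derivative U' k) (at k)" for k
  proof -
    have "((\<lambda>k. integral (cbox a b) (\<lambda>x. exp (- \<i> * k * of_real x) * g x)) has_field_derivative
      integral (cbox a b) (\<lambda>x. - \<i> * of_real x * exp (- \<i> * k * of_real x) * g x)) (at k within UNIV)"
    proof (rule leibniz_rule_field_derivative)
      fix k :: complex and x :: real
      show "((\<lambda>k. exp (- \<i> * k * of_real x) * g x) has_field_derivative
          - \<i> * of_real x * exp (- \<i> * k * of_real x) * g x) (at k within UNIV)"
        by (auto intro!: derivative_eq_intros)
    next
      fix k :: complex
      show "(\<lambda>x. exp (- \<i> * k * of_real x) * g x) integrable_on cbox a b"
        using g by (auto intro!: integrable_continuous_real continuous_intros)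
    next
      have "continuous_on (UNIV \<times> cbox a b) (\<lambda>z. - \<i> * of_real (snd z) *
          exp (- \<i> * fst z * of_real (snd z)) * g (snd z))"
        by (intro continuous_intros continuous_on_compose2[OF g]) auto
      then show "continuous_on (UNIV \<times> cbox a b) (\<lambda>(k, x). - \<i> * of_real x * exp (- \<i> * k * of_real x) * g x)"
        by (simp add: split_beta')
    qed auto
    then show ?thesis by (simp add: U'_def)
  qed
  have e: "norm (exp (- \<i> * k * of_real x) * g x) \<le> B * exp (max 0 (Im k))" if "x \<in> {a..b}" for k x
  proof -
    have "Im k * x \<le> max 0 (Im k) * x" using that ab by (intro mult_right_mono) auto
    also have "\<dots> \<le> max 0 (Im k) * 1" using that ab by (intro mult_left_mono) auto
    finally have "norm (exp (- \<i> * k * of_real x)) \<le> exp (max 0 (Im k))" by simp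
    from mult_mono[OF this B(2)[OF that]] show ?thesis by (simp add: norm_mult mult.commute)
  qed
  have e': "norm (- \<i> * of_real x * exp (- \<i> * k * of_real x) * g x) \<le> B * exp (max 0 (Im k))"
    if "x \<in> {a..b}" for k x
  proof -
    have "norm (- \<i> * of_real x * exp (- \<i> * k * of_real x) * g x) =
        \<bar>x\<bar> * norm (exp (- \<i> * k * of_real x) * g x)"
      by (simp add: norm_mult)
    also have "\<dots> \<le> 1 * (B * exp (max 0 (Im k)))"
      using that ab by (intro mult_mono e) auto
    finally show ?thesis by simp
  qed
  have short: "B * exp (max 0 (Im k)) * (b - a) \<le> B * exp (max 0 (Im k))" for k
    using B(1) ab by (intro mult_left_le) auto
  have "norm (integral {a..b} (\<lambda>x. exp (- \<i> * k * of_real x) * g x)) \<le> B * exp (max 0 (Im k))"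
    "norm (U' k) \<le> B * exp (max 0 (Im k))" for k
    unfolding U'_def
    by (rule order_trans[OF integral_bound short], use ab e e' in \<open>auto intro!: continuous_intros g\<close>)+
  then show ?thesis unfolding entire_of_exp_type_def using der by blast
qed

text \<open>On each piece \<open>u0\<close> agrees, up to the two endpoints, with a continuous function, to which
  differentiation under the integral sign applies; the pieces are added up by induction.\<close>

lemma entire_of_exp_type_uhat:
  assumes "piecewise_C2 u0"
  shows "entire_of_exp_type (uhat u0)"
proof -
  obtain n y where y: "y 0 = 0" "y n = 1" "\<And>j. j < n \<Longrightarrow> y j < y (Suc j)"
    and pc: "\<And>j. j < n \<Longrightarrow> \<exists>g. C2_on {y j..y (Suc j)} g \<and> (\<forall>x\<in>{y j<..<y (Suc j)}. g x = u0 x)"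
    using assms unfolding piecewise_C2_def by blast
  have mono: "y i \<le> y j" if "i \<le> j" "j \<le> n" for i j
    using that
  proof (induction rule: dec_induct)
    case (step m)
    then show ?case using y(3)[of m] by simp
  qed simp
  have "(\<forall>k. (\<lambda>x. exp (- \<i> * k * of_real x) * u0 x) integrable_on {0..y m}) \<and>
      entire_of_exp_type (\<lambda>k. integral {0..y m} (\<lambda>x. exp (- \<i> * k * of_real x) * u0 x))" if "m \<le> n" for m
    using that
  proof (induction m)
    case 0
    then show ?case using entire_of_exp_type_0 y(1) integrable_on_refl[of "f :: real \<Rightarrow> complex" 0 for f] by simp
  next
    case (Suc m)
    define f where "f = (\<lambda>k x. exp (- \<i> * k * of_real x) * u0 x)"
    have IH: "\<And>k. f k integrable_on {0..y m}" "entire_of_exp_type (\<lambda>k. integral {0..y m} (f k))"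
      using Suc by (auto simp: f_def)
    obtain g where g: "C2_on {y m..y (Suc m)} g" "\<And>x. x \<in> {y m<..<y (Suc m)} \<Longrightarrow> g x = u0 x"
      using pc[of m] Suc.prems by auto
    have cont: "continuous_on {y m..y (Suc m)} g"
      using g(1) unfolding C2_on_def by (meson continuous_on_vector_derivative)
    have order: "0 \<le> y m" "y m \<le> y (Suc m)" "y (Suc m) \<le> 1"
      using mono[of 0 m] mono[of m "Suc m"] mono[of "Suc m" n] Suc.prems y by auto
    have eq: "f k x = exp (- \<i> * k * of_real x) * g x" if "x \<in> {y m..y (Suc m)} - {y m, y (Suc m)}" for k x
      using g(2)[of x] that by (auto simp: f_def)
    have int: "f k integrable_on {y m..y (Suc m)}" for k
      by (rule integrable_spike[where S = "{y m, y (Suc m)}", OF integrable_continuous_real _ eq])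
        (auto intro!: continuous_intros cont)
    have "integral {y m..y (Suc m)} (f k) = integral {y m..y (Suc m)} (\<lambda>x. exp (- \<i> * k * of_real x) * g x)" for k
      by (rule integral_spike[where S = "{y m, y (Suc m)}"]) (use eq in auto)
    moreover have "integral {0..y (Suc m)} (f k) = integral {0..y m} (f k) + integral {y m..y (Suc m)} (f k)" for k
      using order by (intro Henstock_Kurzweil_Integration.integral_combine[symmetric]
          Henstock_Kurzweil_Integration.integrable_combine[OF _ _ IH(1) int]) auto
    ultimately have "entire_of_exp_type (\<lambda>k. integral {0..y (Suc m)} (f k))"
      using entire_of_exp_type_add[OF IH(2) entire_of_exp_type_fourier[OF cont order]] by simp
    moreover have "f k integrable_on {0..y (Suc m)}" for k
      using order by (intro Henstock_Kurzweil_Integration.integrable_combine[OF _ _ IH(1) int]) auto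
    ultimately show ?case by (simp add: f_def)
  qed
  then show ?thesis using y(2) by (metis (no_types, lifting) ext order_refl uhat_def)
qed

lemma entire_of_exp_type_on_ray:
  assumes "entire_of_exp_type U"
  shows "C1_exp_order (max 0 (Im v)) (\<lambda>r. U (v * of_real r))"
proof -
  obtain U' M where U: "\<And>k. (U has_field_derivative U' k) (at k)"
     "\<And>k. norm (U k) \<le> M * exp (max 0 (Im k))" "\<And>k. norm (U' k) \<le> M * exp (max 0 (Im k))"
    using assms unfolding entire_of_exp_type_def by blast
  have M: "0 \<le> M" using order_trans[OF norm_ge_zero U(2)[of 0]] by simp
  have mx: "max 0 (Im (v * of_real r)) = max 0 (Im v) * r" if "r \<ge> 1" for r
    using that by (auto simp: max_def mult_le_0_iff zero_le_mult_iff)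
  show ?thesis
  proof (rule C1_exp_orderI[where M = "M + norm v * M"])
    fix r :: real assume r: "r \<ge> 1"
    have "((\<lambda>z. U (v * z)) has_field_derivative U' (v * of_real r) * v) (at (of_real r))"
      by (rule DERIV_chain2[OF U(1)]) (auto intro!: derivative_eq_intros)
    from has_vector_derivative_real_field[OF this]
    show "((\<lambda>r. U (v * of_real r)) has_vector_derivative U' (v * of_real r) * v) (at r within {1..})"
      by (simp add: o_def)
    let ?e = "exp (max 0 (Im v) * r)"
    have nn: "0 \<le> M * ?e" "0 \<le> norm v * (M * ?e)" using M by auto
    have split: "(M + norm v * M) * ?e = M * ?e + norm v * (M * ?e)" by (simp add: algebra_simps)
    show "norm (U (v * of_real r)) \<le> (M + norm v * M) * ?e"
      using U(2)[of "v * of_real r"] nn(2) unfolding mx[OF r] split by linarith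
    have "norm (U' (v * of_real r) * v) \<le> norm v * (M * ?e)"
      using mult_left_mono[OF U(3)[of "v * of_real r"], of "norm v"] unfolding mx[OF r]
      by (simp add: norm_mult mult.commute)
    then show "norm (U' (v * of_real r) * v) \<le> (M + norm v * M) * ?e"
      using nn(1) unfolding split by linarith
  qed
qed

section \<open>The characteristic function and the quotient\<close>

lemma alpha_eq: "alpha = Complex (- 1 / 2) (sqrt 3 / 2)"
proof -
  have "alpha = cis (2 * pi / 3)" by (simp add: alpha_def cis_conv_exp mult_ac)
  then show ?thesis by (simp add: complex_eq_iff cos_120 sin_120)
qed

lemma alpha_square: "alpha\<^sup>2 = Complex (- 1 / 2) (- sqrt 3 / 2)"
  by (simp add: alpha_eq complex_eq_iff power2_eq_square)

lemma alpha_cube: "alpha ^ 3 = 1"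
proof -
  have "alpha ^ 3 = alpha * alpha\<^sup>2" by (simp add: power3_eq_cube power2_eq_square)
  then show ?thesis by (simp only: alpha_square) (simp add: alpha_eq complex_eq_iff)
qed

lemma alpha_mult_square: "alpha * alpha\<^sup>2 = 1" "alpha\<^sup>2 * alpha\<^sup>2 = alpha"
  by (simp_all only: alpha_square) (simp_all add: alpha_eq complex_eq_iff)

lemma alpha_sum: "1 + alpha + alpha\<^sup>2 = 0"
  by (simp only: alpha_square) (simp add: alpha_eq complex_eq_iff)

lemma cube_root_cases:
  assumes "w ^ 3 = 1"
  obtains "w = 1" | "w = alpha" | "w = alpha\<^sup>2"
proof -
  have "(w - 1) * ((w - alpha) * (w - alpha\<^sup>2)) =
      w ^ 3 - (1 + alpha + alpha\<^sup>2) * w\<^sup>2 + (alpha + alpha\<^sup>2 + alpha ^ 3) * w - alpha ^ 3"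
    by (simp add: power2_eq_square power3_eq_cube algebra_simps)
  also have "\<dots> = 0" using assms alpha_sum alpha_cube by (simp add: algebra_simps)
  finally show ?thesis using that by auto
qed

text \<open>The sixth roots of unity lie at the angles \<open>0, \<plusminus>\<pi>/3, \<plusminus>2\<pi>/3, \<pi>\<close>; the value \<open>\<surd>3/2\<close> is the
  growth rate of the dominant exponential in \<open>Delta\<close>.\<close>

lemma sixth_root_Im:
  assumes "w ^ 3 = 1 \<or> w ^ 3 = - 1"
  shows "\<bar>Im w\<bar> \<le> sqrt 3 / 2"
proof -
  have *: "\<bar>Im w\<bar> \<le> sqrt 3 / 2" if "w ^ 3 = 1" for w
    using that by (rule cube_root_cases) (auto simp: alpha_square, auto simp: alpha_eq)
  have "w ^ 3 = 1 \<or> (- w) ^ 3 = 1" using assms by (auto simp: power3_eq_cube)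
  then show ?thesis using *[of w] *[of "- w"] by auto
qed

lemma rotated_sixth_root_Im:
  assumes "w ^ 3 = 1 \<or> w ^ 3 = - 1"
  shows "Im w \<le> sqrt 3 / 2" "Im (alpha * w) \<le> sqrt 3 / 2" "Im (alpha\<^sup>2 * w) \<le> sqrt 3 / 2"
proof -
  have rot: "(alpha * v) ^ 3 = 1 \<or> (alpha * v) ^ 3 = - 1" if "v ^ 3 = 1 \<or> v ^ 3 = - 1" for v
    using that by (simp add: power_mult_distrib alpha_cube)
  show "Im w \<le> sqrt 3 / 2" "Im (alpha * w) \<le> sqrt 3 / 2" "Im (alpha\<^sup>2 * w) \<le> sqrt 3 / 2"
    using abs_le_D1[OF sixth_root_Im[OF assms]] abs_le_D1[OF sixth_root_Im[OF rot[OF assms]]]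
      abs_le_D1[OF sixth_root_Im[OF rot[OF rot[OF assms]]]]
    by (simp_all only: power2_eq_square mult.assoc)
qed

text \<open>Multiplication of the argument by \<open>alpha\<close> permutes the three exponentials cyclically. Hence
  \<open>\<bar>Delta\<bar>\<close> on any of the six rays is \<open>\<bar>Delta\<bar>\<close> on one of the two real half-lines.\<close>

lemma Delta_alpha: "Delta (alpha * k) = alpha\<^sup>2 * Delta k"
proof -
  have "exp (- \<i> * alpha\<^sup>2 * (alpha * k)) = exp (- \<i> * k)"
  proof -
    have "- \<i> * alpha\<^sup>2 * (alpha * k) = - \<i> * (alpha * alpha\<^sup>2) * k" by (simp add: mult_ac)
    then show ?thesis by (simp only: alpha_mult_square mult_1_right)
  qed
  moreover have "exp (- \<i> * alpha * (alpha * k)) = exp (- \<i> * alpha\<^sup>2 * k)"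
    by (simp add: power2_eq_square mult.assoc)
  ultimately have "Delta (alpha * k) = exp (- \<i> * alpha * k) + alpha * exp (- \<i> * alpha\<^sup>2 * k) +
      alpha\<^sup>2 * exp (- \<i> * k)"
    by (simp add: Delta_def mult.assoc)
  also have "\<dots> = (alpha * alpha\<^sup>2) * exp (- \<i> * alpha * k) +
      (alpha\<^sup>2 * alpha\<^sup>2) * exp (- \<i> * alpha\<^sup>2 * k) + alpha\<^sup>2 * exp (- \<i> * k)"
    by (simp only: alpha_mult_square mult_1_left)
  also have "\<dots> = alpha\<^sup>2 * Delta k"
    by (simp add: Delta_def algebra_simps)
  finally show ?thesis .
qed

text \<open>On the real line, factoring out \<open>exp (\<i> s/2)\<close> leaves a number with real part
  \<open>cos (3s/2) - cosh (\<surd>3 s/2)\<close>, whose modulus is at least \<open>cosh (\<surd>3 s/2) - 1\<close>. The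
  bound is this quantity, written so that its exponential growth at infinity and its quadratic
  vanishing at \<open>0\<close> are both visible.\<close>

lemma Delta_lower_bound:
  assumes w: "w ^ 3 = 1 \<or> w ^ 3 = - 1" and r: "r \<ge> 0"
  defines "a \<equiv> sqrt 3 / 2 * r"
  shows "norm (Delta (w * of_real r)) \<ge> exp a * (1 - exp (- a))\<^sup>2 / 2"
proof -
  have real: "norm (Delta (of_real s)) \<ge> exp a * (1 - exp (- a))\<^sup>2 / 2" if s: "s = r \<or> s = - r" for s
  proof -
    define b where "b = sqrt 3 / 2 * s"
    define Z where "Z = exp (- \<i> * of_real (3 / 2 * s)) + alpha * exp (of_real b) + alpha\<^sup>2 * exp (of_real (- b))"
    have "Delta (of_real s) = exp (\<i> * of_real (s / 2)) * Z"
    proof -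
      have "- \<i> * of_real s = \<i> * of_real (s / 2) + (- \<i> * of_real (3 / 2 * s))"
        "- \<i> * alpha * of_real s = \<i> * of_real (s / 2) + of_real b"
        "- \<i> * alpha\<^sup>2 * of_real s = \<i> * of_real (s / 2) + of_real (- b)"
        unfolding alpha_square by (simp_all add: alpha_eq b_def complex_eq_iff)
      then show ?thesis unfolding Delta_def Z_def by (simp only: exp_add distrib_left mult_ac)
    qed
    then have "norm (Delta (of_real s)) = norm Z" by (simp add: norm_mult)
    moreover have "- Re Z \<le> norm Z" using abs_Re_le_cmod[of Z] by linarith
    moreover have "Re Z = cos (3 / 2 * s) - cosh b"
      unfolding Z_def alpha_square cosh_def
      by (simp add: alpha_eq Re_exp Im_exp exp_of_real[symmetric] add_divide_distrib del: exp_of_real)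
    moreover have "cosh b = cosh a" using s by (auto simp: a_def b_def)
    moreover have "exp a * (1 - exp (- a))\<^sup>2 / 2 = cosh a - 1"
      by (simp add: cosh_def exp_minus power2_eq_square field_simps)
    moreover have "cos (3 / 2 * s) \<le> 1" by simp
    ultimately show ?thesis by linarith
  qed
  have rot: "norm (Delta (alpha * k)) = norm (Delta k)" for k
  proof -
    have "norm alpha = 1" by (simp add: alpha_def)
    then show ?thesis by (simp add: Delta_alpha norm_mult norm_power)
  qed
  have cube: "norm (Delta (v * of_real s)) = norm (Delta (of_real s))" if "v ^ 3 = 1" for v s
    using that
  proof (rule cube_root_cases)
    assume "v = alpha\<^sup>2"
    then show ?thesis using rot[of "alpha * of_real s"] rot[of "of_real s"]
      by (simp add: power2_eq_square mult.assoc)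
  qed (use rot in auto)
  have "w ^ 3 = 1 \<or> (- w) ^ 3 = 1" using w by (auto simp: power3_eq_cube)
  then show ?thesis
  proof
    assume "w ^ 3 = 1"
    then show ?thesis using real[of r] cube[of w r] by simp
  next
    assume "(- w) ^ 3 = 1"
    then show ?thesis using real[of "- r"] cube[of "- w" "- r"] by simp
  qed
qed

lemma Delta_nonzero:
  assumes w: "w ^ 3 = 1 \<or> w ^ 3 = - 1" and r: "r > 0"
  shows "Delta (w * of_real r) \<noteq> 0"
proof -
  let ?a = "sqrt 3 / 2 * r"
  have "exp (- ?a) < 1" using r by simp
  then have "0 < (1 - exp (- ?a))\<^sup>2" by (intro zero_less_power) linarith
  then have "0 < exp ?a * (1 - exp (- ?a))\<^sup>2 / 2" by (intro divide_pos_pos mult_pos_pos) auto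
  also have "\<dots> \<le> norm (Delta (w * of_real r))" using assms by (intro Delta_lower_bound) auto
  finally show ?thesis by auto
qed

lemma double_zero_factor:
  assumes "f holomorphic_on UNIV" "f 0 = 0" "(f has_field_derivative 0) (at 0)"
  obtains g where "g holomorphic_on UNIV" "\<And>k. f k = k\<^sup>2 * g k"
proof -
  define f1 where "f1 = (\<lambda>k. if k = 0 then deriv f 0 else f k / k)"
  have f1: "f1 holomorphic_on UNIV"
    by (rule pole_theorem_open_0[OF assms(1) open_UNIV, of 0]) (auto simp: f1_def assms)
  define g where "g = (\<lambda>k. if k = 0 then deriv f1 0 else f1 k / k)"
  have "f1 0 = 0" using assms(3) by (simp add: f1_def DERIV_imp_deriv)
  then have "g holomorphic_on UNIV"
    by (intro pole_theorem_open_0[OF f1 open_UNIV, of 0]) (auto simp: g_def)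
  moreover have "f k = k\<^sup>2 * g k" for k
    using assms(2) by (simp add: g_def f1_def power2_eq_square)
  ultimately show ?thesis using that by blast
qed

text \<open>The values and first derivatives of numerator and denominator at \<open>0\<close> are multiples of
  \<open>1 + alpha + alpha\<^sup>2\<close>, so both are \<open>k\<^sup>2\<close> times an entire function. The factor belonging to \<open>Delta\<close>
  does not vanish at \<open>0\<close>, as the lower bound for \<open>Delta\<close> is quadratic there.\<close>

lemma zeta_minus_over_Delta_extends:
  assumes U: "entire_of_exp_type (uhat u0)"
  obtains Q where "\<And>k. k \<noteq> 0 \<Longrightarrow> Q k = zeta_minus u0 k / Delta k"
    "\<And>w. w ^ 3 = 1 \<or> w ^ 3 = - 1 \<Longrightarrow> continuous_on {0..} (\<lambda>r. Q (w * of_real r))"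
proof -
  obtain U' where U': "\<And>k. (uhat u0 has_field_derivative U' k) (at k)"
    using U unfolding entire_of_exp_type_def by blast
  have chain: "((\<lambda>k. uhat u0 (v * k)) has_field_derivative U' (v * k) * v) (at k)" for v k
    by (rule DERIV_chain2[OF U']) (auto intro!: derivative_eq_intros)
  have z_der: "(zeta_minus u0 has_field_derivative
      U' k + alpha * (U' (alpha * k) * alpha) + alpha\<^sup>2 * (U' (alpha\<^sup>2 * k) * alpha\<^sup>2)) (at k)" for k
    unfolding zeta_minus_def by (intro DERIV_add DERIV_cmult chain U')
  have z_0: "(zeta_minus u0 has_field_derivative 0) (at 0)"
  proof -
    have "U' 0 + alpha * (U' 0 * alpha) + alpha\<^sup>2 * (U' 0 * alpha\<^sup>2) =
        U' 0 * (1 + alpha\<^sup>2 + alpha\<^sup>2 * alpha\<^sup>2)"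
      by (simp add: algebra_simps power2_eq_square)
    also have "\<dots> = 0" unfolding alpha_mult_square using alpha_sum by (simp add: add_ac)
    finally show ?thesis using z_der[of 0] by simp
  qed
  have z_hol: "zeta_minus u0 holomorphic_on UNIV"
    using z_der by (intro holomorphic_onI) (auto simp: field_differentiable_def)
  have "zeta_minus u0 0 = uhat u0 0 * (1 + alpha + alpha\<^sup>2)"
    by (simp add: zeta_minus_def algebra_simps)
  then have "zeta_minus u0 0 = 0" by (simp only: alpha_sum mult_zero_right)
  then obtain gz where gz: "gz holomorphic_on UNIV" "\<And>k. zeta_minus u0 k = k\<^sup>2 * gz k"
    using double_zero_factor[OF z_hol _ z_0] by blast
  have exp_der: "((\<lambda>k. exp (- \<i> * v * k)) has_field_derivative exp (- \<i> * v * k) * (- \<i> * v)) (at k)"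
    for v k :: complex
    by (auto intro!: derivative_eq_intros)
  have d_der: "(Delta has_field_derivative exp (- \<i> * k) * (- \<i>) +
      alpha * (exp (- \<i> * alpha * k) * (- \<i> * alpha)) +
      alpha\<^sup>2 * (exp (- \<i> * alpha\<^sup>2 * k) * (- \<i> * alpha\<^sup>2))) (at k)" for k
    unfolding Delta_def using exp_der[of 1 k] by (intro DERIV_add DERIV_cmult exp_der) simp
  have d_0: "(Delta has_field_derivative 0) (at 0)"
  proof -
    have "- \<i> + alpha * (- \<i> * alpha) + alpha\<^sup>2 * (- \<i> * alpha\<^sup>2) = - \<i> * (1 + alpha\<^sup>2 + alpha\<^sup>2 * alpha\<^sup>2)"
      by (simp add: algebra_simps power2_eq_square)
    also have "\<dots> = 0" unfolding alpha_mult_square using alpha_sum by (simp add: add_ac)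
    finally show ?thesis using d_der[of 0] by simp
  qed
  have d_hol: "Delta holomorphic_on UNIV"
    using d_der by (intro holomorphic_onI) (auto simp: field_differentiable_def)
  have "Delta 0 = 0" using alpha_sum by (simp add: Delta_def)
  then obtain gd where gd: "gd holomorphic_on UNIV" "\<And>k. Delta k = k\<^sup>2 * gd k"
    using double_zero_factor[OF d_hol _ d_0] by blast
  have gd_0: "gd 0 \<noteq> 0"
  proof -
    have low: "norm (gd (of_real r)) \<ge> 3 / 8 * exp (- (sqrt 3 / 2 * r))" if "r > 0" for r
    proof -
      define a where "a = sqrt 3 / 2 * r"
      have a: "a > 0" using that by (simp add: a_def)
      have "a * exp (- a) \<le> 1 - exp (- a)"
        using exp_ge_add_one_self[of a] by (simp add: exp_minus field_simps)
      then have "exp a * (a * exp (- a))\<^sup>2 / 2 \<le> exp a * (1 - exp (- a))\<^sup>2 / 2"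
        using a by (intro divide_right_mono mult_left_mono power_mono) auto
      also have "\<dots> \<le> norm (Delta (1 * of_real r))"
        unfolding a_def using that by (intro Delta_lower_bound) auto
      also have "\<dots> = r\<^sup>2 * norm (gd (of_real r))" by (simp add: gd(2) norm_mult norm_power)
      finally have "exp a * (a * exp (- a))\<^sup>2 / 2 \<le> r\<^sup>2 * norm (gd (of_real r))" .
      moreover have "exp a * (a * exp (- a))\<^sup>2 / 2 = a\<^sup>2 * exp (- a) / 2"
        by (simp add: exp_minus power2_eq_square)
      moreover have "a\<^sup>2 = 3 / 4 * r\<^sup>2" by (simp add: a_def power_mult_distrib power_divide)
      ultimately have "r\<^sup>2 * (3 / 8 * exp (- a)) \<le> r\<^sup>2 * norm (gd (of_real r))" by simp
      then show ?thesis using that by (simp add: a_def)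
    qed
    have "isCont gd (of_real 0)"
      using holomorphic_on_imp_continuous_on[OF gd(1)] by (simp add: continuous_on_eq_continuous_at)
    then have cont: "isCont (\<lambda>r. gd (of_real r)) (0::real)"
      by (intro isCont_o2[of 0 of_real gd]) auto
    have lim1: "((\<lambda>r. norm (gd (of_real r))) \<longlongrightarrow> norm (gd 0)) (at_right (0::real))"
      using cont by (intro tendsto_norm) (auto simp: isCont_def intro: tendsto_within_subset)
    have lim2: "((\<lambda>r. 3 / 8 * exp (- (sqrt 3 / 2 * r))) \<longlongrightarrow> 3 / 8 * exp (- (sqrt 3 / 2 * 0))) (at_right (0::real))"
      by (intro tendsto_intros)
    have "\<forall>\<^sub>F r in at_right 0. 3 / 8 * exp (- (sqrt 3 / 2 * r)) \<le> norm (gd (of_real r))"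
      using eventually_at_right_less[of 0] by eventually_elim (rule low)
    then have "3 / 8 * exp (- (sqrt 3 / 2 * 0)) \<le> norm (gd 0)"
      by (rule tendsto_le[OF trivial_limit_at_right_real lim1 lim2])
    then show ?thesis by auto
  qed
  show ?thesis
  proof (rule that[of "\<lambda>k. gz k / gd k"])
    show "gz k / gd k = zeta_minus u0 k / Delta k" if "k \<noteq> 0" for k
      using that by (simp add: gz gd)
    fix w :: complex assume w: "w ^ 3 = 1 \<or> w ^ 3 = - 1"
    have "gd (w * of_real r) \<noteq> 0" if "r \<ge> 0" for r
      using that gd_0 Delta_nonzero[OF w, of r] gd(2)[of "w * of_real r"] by (cases "r = 0") auto
    then show "continuous_on {0..} (\<lambda>r. gz (w * of_real r) / gd (w * of_real r))"
      by (intro continuous_intros continuous_on_compose2[OF holomorphic_on_imp_continuous_on[OF gz(1)]]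
          continuous_on_compose2[OF holomorphic_on_imp_continuous_on[OF gd(1)]]) auto
  qed
qed

lemma exp_on_ray:
  assumes "Im v \<le> c"
  shows "C1_exp_order c (\<lambda>r. exp (- \<i> * (v * of_real r)))"
  using C1_exp_order_mono[OF C1_exp_order_exp[of "- \<i> * v"], of c] assms by (simp add: mult.assoc)

lemma uhat_on_ray:
  assumes "entire_of_exp_type (uhat u0)" "Im v \<le> c" "0 \<le> c"
  shows "C1_exp_order c (\<lambda>r. uhat u0 (v * of_real r))"
  using C1_exp_order_mono[OF entire_of_exp_type_on_ray[OF assms(1)], of v c] assms by simp

text \<open>For \<open>r \<ge> 1\<close> the factor \<open>1 - exp (- \<surd>3 r/2)\<close> in the lower bound for \<open>Delta\<close> stays away from zero, so
  \<open>Delta\<close> has exact exponential order \<open>\<surd>3/2\<close>.\<close>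

lemma divide_Delta_on_ray:
  assumes w: "w ^ 3 = 1 \<or> w ^ 3 = - 1" and f: "C1_exp_order (sqrt 3 / 2) f"
  shows "C1_exp_order 0 (\<lambda>r. f r / Delta (w * of_real r))"
proof (rule C1_exp_order_divide[OF f])
  note Im = rotated_sixth_root_Im[OF w]
  show "C1_exp_order (sqrt 3 / 2) (\<lambda>r. Delta (w * of_real r))"
    using C1_exp_order_add[OF C1_exp_order_add[OF exp_on_ray[OF Im(1)]
        C1_exp_order_cmult[OF exp_on_ray[OF Im(2)], of alpha]]
        C1_exp_order_cmult[OF exp_on_ray[OF Im(3)], of "alpha\<^sup>2"]]
    by (simp add: Delta_def mult.assoc)
  let ?d = "(1 - exp (- (sqrt 3 / 2)))\<^sup>2 / 2"
  show "0 < ?d" by simp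
  fix r :: real assume r: "r \<ge> 1"
  have "exp (- (sqrt 3 / 2 * r)) \<le> exp (- (sqrt 3 / 2))" using r by simp
  moreover have "exp (- (sqrt 3 / 2)) \<le> 1" by simp
  ultimately have "(1 - exp (- (sqrt 3 / 2)))\<^sup>2 \<le> (1 - exp (- (sqrt 3 / 2 * r)))\<^sup>2"
    by (intro power_mono) linarith+
  then have "?d * exp (sqrt 3 / 2 * r) \<le> exp (sqrt 3 / 2 * r) * (1 - exp (- (sqrt 3 / 2 * r)))\<^sup>2 / 2"
    by simp
  also have "\<dots> \<le> norm (Delta (w * of_real r))" using w r by (intro Delta_lower_bound) auto
  finally show "?d * exp (sqrt 3 / 2 * r) \<le> norm (Delta (w * of_real r))" .
qed

lemma zeta_minus_quotient_on_ray:
  assumes U: "entire_of_exp_type (uhat u0)" and w: "w ^ 3 = 1 \<or> w ^ 3 = - 1"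
  shows "C1_exp_order 0 (\<lambda>r. zeta_minus u0 (w * of_real r) / Delta (w * of_real r))"
proof (rule divide_Delta_on_ray[OF w])
  note Im = rotated_sixth_root_Im[OF w]
  show "C1_exp_order (sqrt 3 / 2) (\<lambda>r. zeta_minus u0 (w * of_real r))"
    using C1_exp_order_add[OF C1_exp_order_add[OF uhat_on_ray[OF U Im(1)]
        C1_exp_order_cmult[OF uhat_on_ray[OF U Im(2)], of alpha]]
        C1_exp_order_cmult[OF uhat_on_ray[OF U Im(3)], of "alpha\<^sup>2"]]
    by (simp add: zeta_minus_def mult.assoc)
qed

text \<open>In \<open>zeta_plus u0 k\<close> the two terms \<open>exp (- \<i> k) uhat u0 k\<close>, of size \<open>exp (\<surd>3 r)\<close> on the rays of
  \<open>\<Gamma>\<^sup>+\<close>, cancel. Each remaining product has one factor of order \<open>\<surd>3/2\<close>, depending on \<open>w\<close>, and one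
  bounded factor, depending on \<open>alpha w\<close> and \<open>alpha\<^sup>2 w\<close>.\<close>

lemma zeta_plus_quotient_on_ray:
  assumes U: "entire_of_exp_type (uhat u0)" and w: "w ^ 3 = 1 \<or> w ^ 3 = - 1"
    and Im: "Im (alpha * w) \<le> 0" "Im (alpha\<^sup>2 * w) \<le> 0"
  shows "C1_exp_order 0 (\<lambda>r. zeta_plus u0 (w * of_real r) / Delta (w * of_real r))"
proof (rule divide_Delta_on_ray[OF w])
  have Im1: "Im w \<le> sqrt 3 / 2" using sixth_root_Im[OF w] by (simp add: abs_le_iff)
  have A: "C1_exp_order 0 (\<lambda>r. alpha * uhat u0 (alpha * w * of_real r) + alpha\<^sup>2 * uhat u0 (alpha\<^sup>2 * w * of_real r))"
    by (intro C1_exp_order_add C1_exp_order_cmult uhat_on_ray U Im order_refl)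
  have B: "C1_exp_order 0 (\<lambda>r. alpha * exp (- \<i> * (alpha * w * of_real r)) + alpha\<^sup>2 * exp (- \<i> * (alpha\<^sup>2 * w * of_real r)))"
    by (intro C1_exp_order_add C1_exp_order_cmult exp_on_ray Im)
  have eq: "zeta_plus u0 (w * of_real r) =
     exp (- \<i> * (w * of_real r)) *
       (alpha * uhat u0 (alpha * w * of_real r) + alpha\<^sup>2 * uhat u0 (alpha\<^sup>2 * w * of_real r)) -
     uhat u0 (w * of_real r) *
       (alpha * exp (- \<i> * (alpha * w * of_real r)) + alpha\<^sup>2 * exp (- \<i> * (alpha\<^sup>2 * w * of_real r)))" for r
    by (simp add: zeta_plus_def zeta_minus_def Delta_def algebra_simps)
  have "C1_exp_order (sqrt 3 / 2 + 0) (\<lambda>r. zeta_plus u0 (w * of_real r))"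
    unfolding eq
    by (intro C1_exp_order_diff C1_exp_order_mult A B exp_on_ray uhat_on_ray U Im1) simp
  then show "C1_exp_order (sqrt 3 / 2) (\<lambda>r. zeta_plus u0 (w * of_real r))" by simp
qed

section \<open>Continuity of the solution\<close>

lemma cis_cubed: "cis \<theta> ^ 3 = cis (3 * \<theta>)"
  by (simp add: power3_eq_cube cis_mult)

lemma cis_cubed_cases:
  assumes "cis (3 * \<theta>) = of_real e" "e = 1 \<or> e = - 1"
  shows "cis \<theta> ^ 3 = 1 \<or> cis \<theta> ^ 3 = - 1"
  unfolding cis_cubed using assms by auto

lemma rcis_cubed:
  assumes "cis (3 * \<theta>) = of_real e"
  shows "rcis r \<theta> ^ 3 = of_real e * of_real r ^ 3"
  unfolding rcis_def power_mult_distrib cis_cubed assms by (simp add: mult.commute)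

text \<open>In the closed lower half plane \<open>\<bar>exp (\<i> k (x - 1))\<bar> \<le> 1\<close> for \<open>x \<le> 1\<close>.\<close>

lemma integrand_minus_ray:
  assumes U: "entire_of_exp_type (uhat u0)" and t: "t \<noteq> 0"
    and \<theta>: "cis (3 * \<theta>) = of_real e" "e = 1 \<or> e = - 1" "sin \<theta> \<le> 0"
  shows "(\<forall>x\<in>{0<..<1}. ray_integrable \<theta> (integrand_minus u0 x t)) \<and>
    continuous_on {0<..<1} (\<lambda>x. ray_integral \<theta> (integrand_minus u0 x t))"
proof -
  note w = cis_cubed_cases[OF \<theta>(1,2)]
  obtain Q where Q: "\<And>k. k \<noteq> 0 \<Longrightarrow> Q k = zeta_minus u0 k / Delta k"
    "continuous_on {0..} (\<lambda>r. Q (cis \<theta> * of_real r))"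
    using zeta_minus_over_Delta_extends[OF U] w by metis
  have h: "C1_exp_order 0 (\<lambda>r. Q (cis \<theta> * of_real r))"
    using zeta_minus_quotient_on_ray[OF U w] by (subst C1_exp_order_cong) (auto simp: Q(1))
  have s: "e * t \<noteq> 0" using t \<theta>(2) by auto
  have c: "Re (\<i> * cis \<theta> * (of_real x - 1)) \<le> 0" "norm (\<i> * cis \<theta> * (of_real x - 1)) \<le> 1"
    if "x \<in> {0<..<1}" for x :: real
  proof -
    have "norm (complex_of_real x - 1) = \<bar>x - 1\<bar>" by (metis norm_of_real of_real_1 of_real_diff)
    then show "norm (\<i> * cis \<theta> * (of_real x - 1)) \<le> 1" using that by (simp add: norm_mult)
    show "Re (\<i> * cis \<theta> * (of_real x - 1)) \<le> 0"
      using \<theta>(3) that by (simp add: mult_nonpos_nonpos)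
  qed
  have cc: "continuous_on {0<..<1::real} (\<lambda>x. \<i> * cis \<theta> * (of_real x - 1))"
    by (intro continuous_intros)
  have F: "integrand_minus u0 x t (rcis r \<theta>) =
     exp (\<i> * of_real (e * t) * of_real r ^ 3 + \<i> * cis \<theta> * (of_real x - 1) * of_real r) * Q (cis \<theta> * of_real r)"
    if "r > 0" for x r
  proof -
    have "rcis r \<theta> = cis \<theta> * of_real r" by (simp add: rcis_def)
    moreover have "cis \<theta> * of_real r \<noteq> 0" using that by simp
    ultimately show ?thesis
      using rcis_cubed[OF \<theta>(1), of r] by (simp add: integrand_minus_def Q(1) algebra_simps)
  qed
  show ?thesis using ray_integral_continuous[OF h Q(2) s c cc F] by blast
qed

text \<open>In the closed upper half plane \<open>\<bar>exp (\<i> k x)\<bar> \<le> 1\<close> for \<open>x \<ge> 0\<close>. The amplitude extends continuously to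
  \<open>k = 0\<close> because \<open>zeta_plus / Delta = exp (- \<i> k) zeta_minus / Delta - uhat\<close>.\<close>

lemma integrand_plus_ray:
  assumes U: "entire_of_exp_type (uhat u0)" and t: "t \<noteq> 0"
    and \<theta>: "cis (3 * \<theta>) = of_real e" "e = 1 \<or> e = - 1" "sin \<theta> \<ge> 0"
    and Im: "Im (alpha * cis \<theta>) \<le> 0" "Im (alpha\<^sup>2 * cis \<theta>) \<le> 0"
  shows "(\<forall>x\<in>{0<..<1}. ray_integrable \<theta> (integrand_plus u0 x t)) \<and>
    continuous_on {0<..<1} (\<lambda>x. ray_integral \<theta> (integrand_plus u0 x t))"
proof -
  note w = cis_cubed_cases[OF \<theta>(1,2)]
  obtain Q where Q: "\<And>k. k \<noteq> 0 \<Longrightarrow> Q k = zeta_minus u0 k / Delta k"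
    "continuous_on {0..} (\<lambda>r. Q (cis \<theta> * of_real r))"
    using zeta_minus_over_Delta_extends[OF U] w by metis
  define h where "h = (\<lambda>r. exp (- \<i> * (cis \<theta> * of_real r)) * Q (cis \<theta> * of_real r) - uhat u0 (cis \<theta> * of_real r))"
  have h_eq: "h r = zeta_plus u0 (cis \<theta> * of_real r) / Delta (cis \<theta> * of_real r)" if "r > 0" for r
    using Delta_nonzero[OF w that] that by (simp add: h_def Q(1) zeta_plus_def diff_divide_distrib)
  have h1: "C1_exp_order 0 h"
    using zeta_plus_quotient_on_ray[OF U w Im] by (subst C1_exp_order_cong) (auto simp: h_eq)
  obtain U' where "\<And>k. (uhat u0 has_field_derivative U' k) (at k)"
    using U unfolding entire_of_exp_type_def by blast
  then have "continuous_on UNIV (uhat u0)"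
    by (meson DERIV_isCont continuous_at_imp_continuous_on)
  then have "continuous_on {0..} (\<lambda>r. uhat u0 (cis \<theta> * of_real r))"
    by (rule continuous_on_compose2) (auto intro!: continuous_intros)
  then have h2: "continuous_on {0..} h"
    unfolding h_def by (intro continuous_intros Q(2))
  have s: "e * t \<noteq> 0" using t \<theta>(2) by auto
  have c: "Re (\<i> * cis \<theta> * of_real x) \<le> 0" "norm (\<i> * cis \<theta> * of_real x) \<le> 1"
    if "x \<in> {0<..<1}" for x :: real
    using that \<theta>(3) by (auto simp: norm_mult)
  have cc: "continuous_on {0<..<1::real} (\<lambda>x. \<i> * cis \<theta> * of_real x)"
    by (intro continuous_intros)
  have F: "integrand_plus u0 x t (rcis r \<theta>) =
     exp (\<i> * of_real (e * t) * of_real r ^ 3 + \<i> * cis \<theta> * of_real x * of_real r) * h r"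
    if "r > 0" for x r
  proof -
    have "rcis r \<theta> = cis \<theta> * of_real r" by (simp add: rcis_def)
    then show ?thesis
      using rcis_cubed[OF \<theta>(1), of r] that by (simp add: integrand_plus_def h_eq algebra_simps)
  qed
  show ?thesis using ray_integral_continuous[OF h1 h2 s c cc F] by blast
qed

text \<open>Each half-line \<open>k = e r\<close>, \<open>e = \<plusminus>1\<close>, carries the cubic phase \<open>e t r\<^sup>3\<close> with amplitude
  \<open>uhat u0 (e r)\<close>, which is bounded for real arguments.\<close>

lemma integrand_line_integral:
  assumes U: "entire_of_exp_type (uhat u0)" and t: "t \<noteq> 0"
  shows "(\<forall>x\<in>{0<..<1}. improper_integrable (integrand_line u0 x t)) \<and>
    continuous_on {0<..<1} (\<lambda>x. improper_integral (integrand_line u0 x t))"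
proof -
  obtain U' where "\<And>k. (uhat u0 has_field_derivative U' k) (at k)"
    using U unfolding entire_of_exp_type_def by blast
  then have contU: "continuous_on UNIV (uhat u0)"
    by (meson DERIV_isCont continuous_at_imp_continuous_on)
  have half: "\<exists>I. continuous_on {0<..<1} I \<and> (\<forall>x\<in>{0<..<1}.
      ((\<lambda>R. integral {0..R} (\<lambda>r. integrand_line u0 x t (e * r))) \<longlongrightarrow> I x) at_top \<and>
      (\<forall>R. (\<lambda>r. integrand_line u0 x t (e * r)) integrable_on {0..R}))"
    if e: "e = 1 \<or> e = - 1" for e :: real
  proof -
    have h1: "C1_exp_order 0 (\<lambda>r. uhat u0 (of_real e * of_real r))"
      by (rule uhat_on_ray[OF U]) auto
    have h2: "continuous_on {0..} (\<lambda>r. uhat u0 (of_real e * of_real r))"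
      by (intro continuous_on_compose2[OF contU] continuous_intros) auto
    have s: "e * t \<noteq> 0" using e t by auto
    have c: "Re (\<i> * of_real (e * x)) \<le> 0" "norm (\<i> * of_real (e * x)) \<le> 1" if "x \<in> {0<..<1}" for x :: real
      using that e by (auto simp: norm_mult)
    have cc: "continuous_on {0<..<1::real} (\<lambda>x. \<i> * of_real (e * x))"
      by (intro continuous_intros)
    have F: "integrand_line u0 x t (e * r) =
       exp (\<i> * of_real (e * t) * of_real r ^ 3 + \<i> * of_real (e * x) * of_real r) * uhat u0 (of_real e * of_real r)"
      for x r
    proof -
      have "complex_of_real e ^ 3 = of_real e" using e by auto
      then show ?thesis by (simp add: integrand_line_def power_mult_distrib algebra_simps)
    qed
    show ?thesis
      by (rule half_line_integral[OF h1 h2 s c cc F]) blast+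
  qed
  obtain I where I: "continuous_on {0<..<1} I" "\<And>x. x \<in> {0<..<1} \<Longrightarrow>
      ((\<lambda>R. integral {0..R} (integrand_line u0 x t)) \<longlongrightarrow> I x) at_top"
      "\<And>x R. x \<in> {0<..<1} \<Longrightarrow> integrand_line u0 x t integrable_on {0..R}"
    using half[of 1] by auto
  obtain J where J: "continuous_on {0<..<1} J" "\<And>x. x \<in> {0<..<1} \<Longrightarrow>
      ((\<lambda>R. integral {0..R} (\<lambda>r. integrand_line u0 x t (- r))) \<longlongrightarrow> J x) at_top"
      "\<And>x R. x \<in> {0<..<1} \<Longrightarrow> (\<lambda>r. integrand_line u0 x t (- r)) integrable_on {0..R}"
    using half[of "- 1"] by auto
  note imp = improper_integral_of_half_lines[OF I(3,2) J(3,2)]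
  have "continuous_on {0<..<1} (\<lambda>x. improper_integral (integrand_line u0 x t))"
    by (subst continuous_on_cong[OF refl imp(2)]) (auto intro!: continuous_intros I J)
  then show ?thesis using imp(1) by blast
qed

theorem theorem2:
  fixes u0 :: "real \<Rightarrow> complex"
  assumes "piecewise_C2 u0"
  shows "\<forall>t>0. (\<forall>x\<in>{0<..<1}. ut_integrals_converge u0 x t) \<and>
           continuous_on {0<..<1} (\<lambda>x. ut_solution u0 x t)"
proof (intro allI impI)
  fix t :: real assume "t > 0"
  then have t: "t \<noteq> 0" by simp
  note U = entire_of_exp_type_uhat[OF assms]
  note line = integrand_line_integral[OF U t]
  have cis_vals: "cis (pi / 3) = Complex (1 / 2) (sqrt 3 / 2)"
    "cis (2 * pi / 3) = Complex (- 1 / 2) (sqrt 3 / 2)"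
    by (simp_all add: complex_eq_iff cos_60 sin_60 cos_120 sin_120)
  have p1: "(\<forall>x\<in>{0<..<1}. ray_integrable (pi/3) (integrand_plus u0 x t)) \<and>
    continuous_on {0<..<1} (\<lambda>x. ray_integral (pi/3) (integrand_plus u0 x t))"
    by (rule integrand_plus_ray[OF U t, where e = "- 1"], unfold cis_vals alpha_square)
      (simp_all add: alpha_eq complex_eq_iff sin_60)
  have p2: "(\<forall>x\<in>{0<..<1}. ray_integrable (2*pi/3) (integrand_plus u0 x t)) \<and>
    continuous_on {0<..<1} (\<lambda>x. ray_integral (2*pi/3) (integrand_plus u0 x t))"
    by (rule integrand_plus_ray[OF U t, where e = 1], unfold cis_vals alpha_square)
      (simp_all add: alpha_eq complex_eq_iff sin_120)
  have m1: "(\<forall>x\<in>{0<..<1}. ray_integrable (-pi) (integrand_minus u0 x t)) \<and>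
    continuous_on {0<..<1} (\<lambda>x. ray_integral (-pi) (integrand_minus u0 x t))"
    using cos_periodic[of pi] sin_periodic[of pi]
    by (intro integrand_minus_ray[OF U t, where e = "- 1"]) (simp_all add: complex_eq_iff)
  have m2: "(\<forall>x\<in>{0<..<1}. ray_integrable (-2*pi/3) (integrand_minus u0 x t)) \<and>
    continuous_on {0<..<1} (\<lambda>x. ray_integral (-2*pi/3) (integrand_minus u0 x t))"
    by (rule integrand_minus_ray[OF U t, where e = 1]) (simp_all add: complex_eq_iff sin_120)
  have m3: "(\<forall>x\<in>{0<..<1}. ray_integrable (-pi/3) (integrand_minus u0 x t)) \<and>
    continuous_on {0<..<1} (\<lambda>x. ray_integral (-pi/3) (integrand_minus u0 x t))"
    by (rule integrand_minus_ray[OF U t, where e = "- 1"]) (simp_all add: complex_eq_iff sin_60)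
  have m4: "(\<forall>x\<in>{0<..<1}. ray_integrable 0 (integrand_minus u0 x t)) \<and>
    continuous_on {0<..<1} (\<lambda>x. ray_integral 0 (integrand_minus u0 x t))"
    by (rule integrand_minus_ray[OF U t, where e = 1]) simp_all
  have "\<forall>x\<in>{0<..<1}. ut_integrals_converge u0 x t"
    using line p1 p2 m1 m2 m3 m4
    by (simp add: ut_integrals_converge_def Gamma_plus_integrable_def Gamma_minus_integrable_def
        sector_boundary_integrable_def)
  moreover have "continuous_on {0<..<1} (\<lambda>x. ut_solution u0 x t)"
    unfolding ut_solution_def Gamma_plus_integral_def Gamma_minus_integral_def sector_boundary_integral_def
    by (intro continuous_on_add continuous_on_diff continuous_on_mult continuous_on_const)
      (use line p1 p2 m1 m2 m3 m4 in blast)+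
  ultimately show "(\<forall>x\<in>{0<..<1}. ut_integrals_converge u0 x t) \<and>
      continuous_on {0<..<1} (\<lambda>x. ut_solution u0 x t)" by blast
qed

end
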